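(* Let $\phi=(\phi_1,\dots,\phi_m)$ be any probability distribution on the ordered symbols $s_1\prec\dots\prec s_m$ with $\phi_1,\phi_2,\phi_{m-1},\phi_m>0$. Then one can construct in linear time (i.e. $O(m)$ time) an alphabetic code $C$ for $s_1\prec\dots\prec s_m$ whose average length satisfies $$\begin{aligned}\mathbb{E}[C]\le{}& H(\phi)+2-\phi_1\bigl(2-\log_2\phi_1-\lceil-\log_2\phi_1\rceil\bigr)-\phi_m\bigl(2-\log_2\phi_m-\lceil-\log_2\phi_m\rceil\bigr)\\&-\sum_{i=1}^{m-1}\min(\phi_i,\phi_{i+1})\\&-\phi_1\max\bigl(0,\lceil-\log_2\phi_1\rceil-\lceil-\log_2\phi_2\rceil-2\bigr)\\&-\phi_m\max\bigl(0,\lceil-\log_2\phi_m\rceil-\lceil-\log_2\phi_{m-1}\rceil-2\bigr).\end{aligned}$$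
   Context: A (binary) alphabetic code for ordered symbols $s_1\prec\dots\prec s_m$ is a map $w:\{s_1,\dots,s_m\}\to\{0,1\}^+$ that is order preserving with respect to the alphabetical (lexicographic) order on binary strings and prefix-free; equivalently, it is a binary tree with edges labelled $0$ (left) and $1$ (right) whose leaves, read from left to right, are $s_1,\dots,s_m$, the codeword $w(s_i)$ being the sequence of labels on the path from the root to the leaf $s_i$. If $\ell_i$ is the length of $w(s_i)$, the average length of $C$ under $\phi$ is $\mathbb{E}[C]=\sum_{i=1}^m\phi_i\ell_i$. $H(\phi)=-\sum_{i=1}^m\phi_i\log_2\phi_i$ is the Shannon entropy (with $0\log_2 0=0$). Running time counts elementary operations on numbers (arithmetic, comparisons, floors/ceilings, base-2 logarithms, bitwise XOR) at unit cost.
   Formalization: The case m=2 with φ=(1/2,1/2) is excluded: there the right-hand side equals 1/2, while every alphabetic code for two symbols has average length at least 1; all other distributions with m≥2 are covered. *)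

theory Defs
  imports Complex_Main "HOL-Library.Sublist"
begin

section \<open>Alphabetic codes\<close>

text \<open>Symbols are the numbers \<open>1, \<dots>, m\<close> in their usual order; binary strings are boolean lists,
  with \<open>False\<close> for the letter 0 (left) and \<open>True\<close> for the letter 1 (right).\<close>

definition prob_distribution :: "nat \<Rightarrow> (nat \<Rightarrow> real) \<Rightarrow> bool" where
  "prob_distribution m \<phi> \<longleftrightarrow> (\<forall>i\<in>{1..m}. 0 \<le> \<phi> i) \<and> (\<Sum>i=1..m. \<phi> i) = 1"

definition alphabetic_code :: "nat \<Rightarrow> (nat \<Rightarrow> bool list) \<Rightarrow> bool" where
  "alphabetic_code m w \<longleftrightarrow>
     (\<forall>i\<in>{1..m}. w i \<noteq> []) \<and>
     (\<forall>i\<in>{1..m}. \<forall>j\<in>{1..m}. i < j \<longrightarrow> (w i, w j) \<in> lexord {(False, True)}) \<and>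
     (\<forall>i\<in>{1..m}. \<forall>j\<in>{1..m}. i \<noteq> j \<longrightarrow> \<not> prefix (w i) (w j))"

definition avg_length :: "nat \<Rightarrow> (nat \<Rightarrow> real) \<Rightarrow> (nat \<Rightarrow> bool list) \<Rightarrow> real" where
  "avg_length m \<phi> w = (\<Sum>i=1..m. \<phi> i * real (length (w i)))"

text \<open>The convention \<open>0 log 0 = 0\<close> is automatic, since the logarithm is total.\<close>

definition entropy :: "nat \<Rightarrow> (nat \<Rightarrow> real) \<Rightarrow> real" where
  "entropy m \<phi> = - (\<Sum>i=1..m. \<phi> i * log 2 (\<phi> i))"


section \<open>A unit-cost machine on real numbers\<close>

text \<open>Bitwise XOR of numbers: integer parts are combined by the XOR of the library, and the
  fractional binary digits one by one. The \<open>k\<close>-th digit of \<open>x\<close> after the binary point is the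
  parity of \<open>\<lfloor>2 ^ k * x\<rfloor>\<close>, i.e. dyadic rationals are read in their terminating expansion.\<close>

definition real_xor :: "real \<Rightarrow> real \<Rightarrow> real" where
  "real_xor x y = real_of_int (semiring_bit_operations_class.xor \<lfloor>x\<rfloor> \<lfloor>y\<rfloor>) +
     (\<Sum>n. of_bool (odd \<lfloor>2 ^ Suc n * x\<rfloor> \<noteq> odd \<lfloor>2 ^ Suc n * y\<rfloor>) / 2 ^ Suc n)"

lemma real_xor_of_int:
  "real_xor (of_int a) (of_int b) = of_int (semiring_bit_operations_class.xor a b)"
proof -
  have "even \<lfloor>2 ^ Suc n * (of_int c :: real)\<rfloor>" for n c
  proof -
    have "2 ^ Suc n * (of_int c :: real) = of_int (2 ^ Suc n * c)" by simp
    then have "\<lfloor>2 ^ Suc n * (of_int c :: real)\<rfloor> = 2 ^ Suc n * c" by (metis floor_of_int)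
    then show ?thesis by simp
  qed
  then show ?thesis by (simp add: real_xor_def del: power_Suc)
qed

lemma real_xor_summable:
  "summable (\<lambda>n. of_bool (odd \<lfloor>2 ^ Suc n * x\<rfloor> \<noteq> odd \<lfloor>2 ^ Suc n * y\<rfloor>) / 2 ^ Suc n :: real)"
proof (rule summable_comparison_test')
  show "summable (\<lambda>n. (1 / 2) ^ n :: real)" by (simp add: summable_geometric)
  show "norm (of_bool (odd \<lfloor>2 ^ Suc n * x\<rfloor> \<noteq> odd \<lfloor>2 ^ Suc n * y\<rfloor>) / 2 ^ Suc n :: real)
          \<le> (1 / 2) ^ n" if "n \<ge> 0" for n
    by (simp add: power_divide field_simps)
qed

text \<open>Programs are the commands of a small imperative language over real-valued scalar variables
  and arrays. Only integer constants may occur in a program, so that no information about the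
  infinitely many inputs can be stored in it.\<close>

datatype unop = Floor_op | Ceiling_op | Log2_op

datatype binop = Add_op | Sub_op | Mul_op | Div_op | Xor_op

datatype aexp =
    Const int
  | Var nat
  | Cell nat aexp  \<comment> \<open>array name, index\<close>
  | Unop unop aexp
  | Binop binop aexp aexp

datatype bexp = Less aexp aexp | Neg bexp | Conj bexp bexp

datatype com =
    SKIP
  | Assign nat aexp
  | Store nat aexp aexp  \<comment> \<open>array name, index, new value\<close>
  | Seq com com
  | IF bexp com com
  | WHILE bexp com

record state =
  var :: "nat \<Rightarrow> real"
  arr :: "nat \<Rightarrow> nat \<Rightarrow> real"

fun apply_unop :: "unop \<Rightarrow> real \<Rightarrow> real" where
  "apply_unop Floor_op x = of_int \<lfloor>x\<rfloor>"
| "apply_unop Ceiling_op x = of_int \<lceil>x\<rceil>"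
| "apply_unop Log2_op x = (if x > 0 then log 2 x else 0)"

fun apply_binop :: "binop \<Rightarrow> real \<Rightarrow> real \<Rightarrow> real" where
  "apply_binop Add_op x y = x + y"
| "apply_binop Sub_op x y = x - y"
| "apply_binop Mul_op x y = x * y"
| "apply_binop Div_op x y = x / y"
| "apply_binop Xor_op x y = real_xor x y"

fun aval :: "aexp \<Rightarrow> state \<Rightarrow> real" where
  "aval (Const c) s = of_int c"
| "aval (Var x) s = var s x"
| "aval (Cell a e) s = arr s a (nat \<lfloor>aval e s\<rfloor>)"
| "aval (Unop f e) s = apply_unop f (aval e s)"
| "aval (Binop f e1 e2) s = apply_binop f (aval e1 s) (aval e2 s)"

fun bval :: "bexp \<Rightarrow> state \<Rightarrow> bool" where
  "bval (Less e1 e2) s \<longleftrightarrow> aval e1 s < aval e2 s"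
| "bval (Neg b) s \<longleftrightarrow> \<not> bval b s"
| "bval (Conj b1 b2) s \<longleftrightarrow> bval b1 s \<and> bval b2 s"

text \<open>Every node of the syntax tree of an evaluated expression is charged one unit.\<close>

fun acost :: "aexp \<Rightarrow> nat" where
  "acost (Const c) = 1"
| "acost (Var x) = 1"
| "acost (Cell a e) = 1 + acost e"
| "acost (Unop f e) = 1 + acost e"
| "acost (Binop f e1 e2) = 1 + acost e1 + acost e2"

fun bcost :: "bexp \<Rightarrow> nat" where
  "bcost (Less e1 e2) = 1 + acost e1 + acost e2"
| "bcost (Neg b) = 1 + bcost b"
| "bcost (Conj b1 b2) = 1 + bcost b1 + bcost b2"

text \<open>\<open>exec c s n t\<close>: started in state \<open>s\<close>, the command \<open>c\<close> terminates in state \<open>t\<close>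
  after \<open>n\<close> units of time.\<close>

inductive exec :: "com \<Rightarrow> state \<Rightarrow> nat \<Rightarrow> state \<Rightarrow> bool" where
  Skip: "exec SKIP s 1 s"
| Assign: "exec (Assign x e) s (1 + acost e) (s\<lparr>var := (var s)(x := aval e s)\<rparr>)"
| Store: "exec (Store a e1 e2) s (1 + acost e1 + acost e2)
    (s\<lparr>arr := (arr s)(a := (arr s a)(nat \<lfloor>aval e1 s\<rfloor> := aval e2 s))\<rparr>)"
| Seq: "exec c1 s n1 s' \<Longrightarrow> exec c2 s' n2 t \<Longrightarrow> exec (Seq c1 c2) s (n1 + n2) t"
| IfTrue: "bval b s \<Longrightarrow> exec c1 s n t \<Longrightarrow> exec (IF b c1 c2) s (1 + bcost b + n) t"
| IfFalse: "\<not> bval b s \<Longrightarrow> exec c2 s n t \<Longrightarrow> exec (IF b c1 c2) s (1 + bcost b + n) t"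
| WhileFalse: "\<not> bval b s \<Longrightarrow> exec (WHILE b c) s (1 + bcost b) s"
| WhileTrue: "bval b s \<Longrightarrow> exec c s n1 s' \<Longrightarrow> exec (WHILE b c) s' n2 t \<Longrightarrow>
    exec (WHILE b c) s (1 + bcost b + n1 + n2) t"

lemma exec_deterministic:
  "exec c s n t \<Longrightarrow> exec c s n' t' \<Longrightarrow> n = n' \<and> t = t'"
proof (induction arbitrary: n' t' rule: exec.induct)
  case (Seq c1 s n1 s' c2 n2 t)
  from Seq.prems show ?case
    by (cases rule: exec.cases) (use Seq.IH in blast)+
next
  case (IfTrue b s c1 n t c2)
  from IfTrue.prems show ?case
    by (cases rule: exec.cases) (use IfTrue.IH IfTrue.hyps in blast)+
next
  case (IfFalse b s c2 n t c1)
  from IfFalse.prems show ?case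
    by (cases rule: exec.cases) (use IfFalse.IH IfFalse.hyps in blast)+
next
  case (WhileTrue b s c n1 s' n2 t)
  from WhileTrue.prems show ?case
    by (cases rule: exec.cases) (use WhileTrue.IH WhileTrue.hyps in blast)+
qed (erule exec.cases; simp)+


section \<open>Input and output\<close>

definition input_state :: "nat \<Rightarrow> (nat \<Rightarrow> real) \<Rightarrow> state" where
  "input_state m \<phi> =
     \<lparr>var = (\<lambda>x. if x = 0 then real m else 0),
      arr = (\<lambda>a i. if a = 0 \<and> i \<in> {1..m} then \<phi> i else 0)\<rparr>"

text \<open>The codewords of a code may have total length of order \<open>m\<^sup>2\<close>, so a code is output as its
  binary tree. Nodes are natural numbers: \<open>1, \<dots>, m\<close> are the leaves \<open>s\<^sub>1, \<dots>, s\<^sub>m\<close>, larger numbers are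
  inner nodes, and 0 stands for a missing child. The left and right children of the inner node \<open>v\<close>
  are found in cell \<open>v\<close> of the arrays 1 and 2, and the root is found in variable 1.\<close>

inductive tree_path :: "nat \<Rightarrow> state \<Rightarrow> nat \<Rightarrow> bool list \<Rightarrow> nat \<Rightarrow> bool" for m s where
  Nil: "tree_path m s v [] v"
| Cons: "m < v \<Longrightarrow> arr s (if b then 2 else 1) v = real u \<Longrightarrow> tree_path m s u bs v' \<Longrightarrow>
    tree_path m s v (b # bs) v'"

definition outputs_code :: "nat \<Rightarrow> state \<Rightarrow> (nat \<Rightarrow> bool list) \<Rightarrow> bool" where
  "outputs_code m s w \<longleftrightarrow>
     (\<exists>root. var s 1 = real root \<and>
        (\<forall>i\<in>{1..m}. \<forall>bs. tree_path m s root bs i \<longleftrightarrow> bs = w i))"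

end

theory Submission
  imports Defs
begin

text \<open>Let \<open>c\<^sub>i\<close> be the midpoint of the mass of symbol \<open>i\<close> in the unit interval. The Gilbert--Moore
  code cuts the binary expansion of \<open>c\<^sub>i\<close> off at about \<open>2 - log\<^sub>2 \<phi>\<^sub>i\<close> digits; the code used here is
  the trie of these expansions with all nodes of outdegree one contracted. Each gap between
  neighbouring symbols is a branching node, and contraction saves at least \<open>min(\<phi>\<^sub>i, \<phi>\<^sub>i\<^sub>+\<^sub>1)\<close> for it:
  if the dyadic intervals of both neighbours reached up to the split point, their masses would
  overlap there.

  The contracted trie is the Cartesian tree, with maxima on top, of the keys
  \<open>2 (c\<^sub>i\<^sub>+\<^sub>1 AND NOT c\<^sub>i)\<close>, which decrease with the length of the common prefix of \<open>c\<^sub>i\<close> and \<open>c\<^sub>i\<^sub>+\<^sub>1\<close>.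
  The usual stack algorithm builds it in linear time. The sentinel \<open>c\<^sub>m\<^sub>+\<^sub>1 = 1\<close> gives a last key 2,
  above all others, which empties the stack.\<close>

section \<open>Comparing common prefixes by exclusive or\<close>

text \<open>The first \<open>N\<close> digits telescope to
  \<open>\<lfloor>2 ^ N * x\<rfloor> / 2 ^ N - \<lfloor>x\<rfloor>\<close>, and rounding down loses
  less than \<open>(1 / 2) ^ N\<close>.\<close>

lemma bits_sums:
  "(\<lambda>n. of_bool (odd \<lfloor>2 ^ Suc n * x\<rfloor>) / 2 ^ Suc n) sums (x - of_int \<lfloor>x\<rfloor>)" for x :: real
proof -
  let ?d = "\<lambda>n. of_bool (odd \<lfloor>2 ^ Suc n * x\<rfloor>) / 2 ^ Suc n :: real"
  have bit: "real_of_int \<lfloor>2 * y\<rfloor> = 2 * real_of_int \<lfloor>y\<rfloor> + of_bool (odd \<lfloor>2 * y\<rfloor>)" for y :: real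
  proof -
    have "\<lfloor>2 * y\<rfloor> = 2 * \<lfloor>y\<rfloor> \<or> \<lfloor>2 * y\<rfloor> = 2 * \<lfloor>y\<rfloor> + 1" by linarith
    then show ?thesis by auto
  qed
  have part: "sum ?d {..<N} = of_int \<lfloor>2 ^ N * x\<rfloor> / 2 ^ N - of_int \<lfloor>x\<rfloor>" for N
  proof (induction N)
    case (Suc N)
    show ?case
      using bit[of "2 ^ N * x"] Suc by (simp add: field_simps)
  qed simp
  have "(\<lambda>N. of_int \<lfloor>2 ^ N * x\<rfloor> / 2 ^ N) \<longlonglongrightarrow> x"
  proof (rule tendsto_sandwich)
    show "\<forall>\<^sub>F N in sequentially. x - (1 / 2) ^ N \<le> of_int \<lfloor>2 ^ N * x\<rfloor> / 2 ^ N"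
    proof (intro always_eventually allI)
      fix N
      have "2 ^ N * x - 1 \<le> of_int \<lfloor>2 ^ N * x\<rfloor>" by linarith
      then show "x - (1 / 2) ^ N \<le> of_int \<lfloor>2 ^ N * x\<rfloor> / 2 ^ N"
        by (simp add: power_divide pos_le_divide_eq left_diff_distrib mult.commute[of _ x])
    qed
    show "\<forall>\<^sub>F N in sequentially. of_int \<lfloor>2 ^ N * x\<rfloor> / 2 ^ N \<le> x"
    proof (intro always_eventually allI)
      fix N
      have "of_int \<lfloor>2 ^ N * x\<rfloor> \<le> 2 ^ N * x" by linarith
      then show "of_int \<lfloor>2 ^ N * x\<rfloor> / 2 ^ N \<le> x"
        by (simp add: field_simps)
    qed
    have "(\<lambda>N. x - (1 / 2) ^ N) \<longlonglongrightarrow> x - 0"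
      by (intro tendsto_diff tendsto_const LIMSEQ_power_zero) auto
    then show "(\<lambda>N. x - (1 / 2) ^ N) \<longlonglongrightarrow> x" by simp
  qed auto
  then have "(\<lambda>N. of_int \<lfloor>2 ^ N * x\<rfloor> / 2 ^ N - of_int \<lfloor>x\<rfloor>) \<longlonglongrightarrow> x - of_int \<lfloor>x\<rfloor>"
    by (intro tendsto_intros)
  then show ?thesis
    unfolding sums_def part .
qed

lemma floor_pow_eq_mono:
  fixes a b :: real
  assumes "\<lfloor>2 ^ n * a\<rfloor> = \<lfloor>2 ^ n * b\<rfloor>" "j \<le> n"
  shows "\<lfloor>2 ^ j * a\<rfloor> = \<lfloor>2 ^ j * b\<rfloor>"
proof -
  have "\<lfloor>2 ^ j * x\<rfloor> = \<lfloor>2 ^ n * x\<rfloor> div 2 ^ (n - j)" for x :: real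
  proof -
    have "(2::real) ^ j = 2 ^ n / 2 ^ (n - j)"
      using assms(2) by (simp add: power_diff)
    then have "2 ^ j * x = 2 ^ n * x / real_of_int (2 ^ (n - j))" by simp
    then show ?thesis
      using floor_divide_real_eq_div[of "2 ^ (n - j)" "2 ^ n * x"] by simp
  qed
  then show ?thesis using assms(1) by simp
qed

text \<open>On binary expansions, half of this number is \<open>b AND NOT a\<close>. Unlike the exclusive or alone,
  which can reach the power of two above its leading digit (as for 1/3 and 2/3), it determines the
  first position where \<open>a < b\<close> differ.\<close>

definition split_key :: "real \<Rightarrow> real \<Rightarrow> real" where
  "split_key a b = real_xor a b + b - a"

text \<open>Digit by digit, exclusive or plus the digit of \<open>b\<close> minus that of
  \<open>a\<close> is 2 for the digits 1 of \<open>b\<close> and 0 of \<open>a\<close>, and 0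
  otherwise.\<close>

lemma split_key_sums:
  assumes "0 \<le> a" "a < 1" "0 \<le> b" "b < 1"
  shows "(\<lambda>n. 2 * of_bool (odd \<lfloor>2 ^ Suc n * b\<rfloor> \<and> even \<lfloor>2 ^ Suc n * a\<rfloor>) / 2 ^ Suc n)
    sums split_key a b"
proof -
  have fl: "\<lfloor>a\<rfloor> = 0" "\<lfloor>b\<rfloor> = 0" using assms by (auto simp: floor_eq_iff)
  let ?x = "\<lambda>n. of_bool (odd \<lfloor>2 ^ Suc n * a\<rfloor> \<noteq> odd \<lfloor>2 ^ Suc n * b\<rfloor>) / 2 ^ Suc n :: real"
  have "?x sums real_xor a b"
    unfolding real_xor_def using summable_sums[OF real_xor_summable[of a b]] fl by simp
  moreover have "(\<lambda>n. of_bool (odd \<lfloor>2 ^ Suc n * a\<rfloor>) / 2 ^ Suc n) sums a"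
    "(\<lambda>n. of_bool (odd \<lfloor>2 ^ Suc n * b\<rfloor>) / 2 ^ Suc n) sums b"
    using bits_sums[of a] bits_sums[of b] fl by simp_all
  ultimately have "(\<lambda>n. ?x n + of_bool (odd \<lfloor>2 ^ Suc n * b\<rfloor>) / 2 ^ Suc n
      - of_bool (odd \<lfloor>2 ^ Suc n * a\<rfloor>) / 2 ^ Suc n) sums split_key a b"
    unfolding split_key_def by (intro sums_add sums_diff)
  moreover have "?x n + of_bool (odd \<lfloor>2 ^ Suc n * b\<rfloor>) / 2 ^ Suc n
      - of_bool (odd \<lfloor>2 ^ Suc n * a\<rfloor>) / 2 ^ Suc n
      = 2 * of_bool (odd \<lfloor>2 ^ Suc n * b\<rfloor> \<and> even \<lfloor>2 ^ Suc n * a\<rfloor>) / 2 ^ Suc n" for n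
    by (cases "odd \<lfloor>2 ^ Suc n * b\<rfloor>"; cases "odd \<lfloor>2 ^ Suc n * a\<rfloor>") (simp_all del: power_Suc)
  ultimately show ?thesis by simp
qed

text \<open>Only digits of \<open>b\<close> behind position \<open>n\<close> contribute, with
  doubled weight, and they sum to strictly less than \<open>1 / 2 ^ n\<close>. With
  \<open>split_key_ge\<close>, pairs \<open>a < b\<close> that first differ at digit
  \<open>Suc n\<close> have keys from \<open>1 / 2 ^ n\<close> up to but excluding
  \<open>2 / 2 ^ n\<close>, so keys compare like split levels.\<close>

lemma split_key_less:
  assumes "0 \<le> a" "a < 1" "0 \<le> b" "b < 1" and eq: "\<lfloor>2 ^ n * a\<rfloor> = \<lfloor>2 ^ n * b\<rfloor>"
  shows "split_key a b < 2 / 2 ^ n"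
proof -
  let ?d = "\<lambda>k. of_bool (odd \<lfloor>2 ^ Suc k * b\<rfloor>) / 2 ^ Suc k :: real"
  have fl: "\<lfloor>b\<rfloor> = 0" using assms by (auto simp: floor_eq_iff)
  have "(\<lambda>k. 2 * (?d k - (if k < n then ?d k else 0))) sums (2 * (b - sum ?d {..<n}))"
    using bits_sums[of b] sums_If_finite_set[of "{..<n}" ?d] fl
    by (intro sums_mult sums_diff) simp_all
  moreover have "2 * of_bool (odd \<lfloor>2 ^ Suc k * b\<rfloor> \<and> even \<lfloor>2 ^ Suc k * a\<rfloor>) / 2 ^ Suc k
      \<le> 2 * (?d k - (if k < n then ?d k else 0))" for k
    using floor_pow_eq_mono[OF eq, of "Suc k"] by (auto simp del: power_Suc)
  ultimately have "split_key a b \<le> 2 * (b - sum ?d {..<n})"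
    by (intro sums_le[OF _ split_key_sums[OF assms(1-4)]])
  also have "sum ?d {..<n} = of_int \<lfloor>2 ^ n * b\<rfloor> / 2 ^ n"
  proof (induction n)
    case (Suc n)
    have "\<lfloor>2 * (2 ^ n * b)\<rfloor> = 2 * \<lfloor>2 ^ n * b\<rfloor> \<or> \<lfloor>2 * (2 ^ n * b)\<rfloor> = 2 * \<lfloor>2 ^ n * b\<rfloor> + 1"
      by linarith
    then show ?case
      using Suc by (auto simp: field_simps)
  qed (use fl in simp)
  also have "2 * (b - of_int \<lfloor>2 ^ n * b\<rfloor> / 2 ^ n) < 2 / 2 ^ n"
  proof -
    have "2 ^ n * b < of_int \<lfloor>2 ^ n * b\<rfloor> + 1" by linarith
    then have "b < (of_int \<lfloor>2 ^ n * b\<rfloor> + 1) / 2 ^ n"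
      by (simp add: pos_less_divide_eq mult.commute)
    then show ?thesis by (simp add: add_divide_distrib)
  qed
  finally show ?thesis .
qed

text \<open>Digit \<open>Suc n\<close> is 1 in \<open>b\<close> and 0 in \<open>a\<close>, and alone
  contributes \<open>2 / 2 ^ Suc n\<close>.\<close>

lemma split_key_ge:
  assumes "0 \<le> a" "a < 1" "0 \<le> b" "b < 1"
    and eq: "\<lfloor>2 ^ n * a\<rfloor> = \<lfloor>2 ^ n * b\<rfloor>" and lt: "\<lfloor>2 ^ Suc n * a\<rfloor> < \<lfloor>2 ^ Suc n * b\<rfloor>"
  shows "1 / 2 ^ n \<le> split_key a b"
proof -
  let ?t = "\<lambda>k. 2 * of_bool (odd \<lfloor>2 ^ Suc k * b\<rfloor> \<and> even \<lfloor>2 ^ Suc k * a\<rfloor>) / 2 ^ Suc k :: real"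
  have "\<lfloor>2 * y\<rfloor> = 2 * \<lfloor>y\<rfloor> \<or> \<lfloor>2 * y\<rfloor> = 2 * \<lfloor>y\<rfloor> + 1" for y :: real by linarith
  from this[of "2 ^ n * a"] this[of "2 ^ n * b"] have
    "\<lfloor>2 ^ Suc n * a\<rfloor> = 2 * \<lfloor>2 ^ n * b\<rfloor>" "\<lfloor>2 ^ Suc n * b\<rfloor> = 2 * \<lfloor>2 ^ n * b\<rfloor> + 1"
    using eq lt by (auto simp: mult.assoc)
  then have "1 / 2 ^ n = sum ?t {n}" by (simp del: power_Suc) simp
  also have "\<dots> \<le> split_key a b"
    using sum_le_suminf[of ?t "{n}"] split_key_sums[OF assms(1-4)]
    by (simp add: sums_iff)
  finally show ?thesis .
qed

text \<open>All fractional digits of 1 vanish, so the exclusive or only adds the integer bit to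
  \<open>a\<close>.\<close>

lemma split_key_one:
  assumes "0 \<le> a" "a < 1"
  shows "split_key a 1 = 2"
proof -
  have fl: "\<lfloor>a\<rfloor> = 0" using assms by (auto simp: floor_eq_iff)
  have "even \<lfloor>2 ^ Suc n :: real\<rfloor>" for n
    by (metis dvd_triv_left floor_numeral_power power_Suc)
  then have "real_xor a 1 = 1 + a"
    using bits_sums[of a] fl by (simp add: real_xor_def sums_iff del: power_Suc)
  then show ?thesis by (simp add: split_key_def)
qed

section \<open>Cartesian trees as alphabetic codes\<close>

text \<open>The label of an inner node is a gap: gap \<open>j\<close> separates the leaves
  \<open>j\<close> and \<open>Suc j\<close>.\<close>

datatype gap_tree = Leaf nat | Node gap_tree nat gap_tree

fun path :: "gap_tree \<Rightarrow> nat \<Rightarrow> bool list" where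
  "path (Leaf _) i = []"
| "path (Node l j r) i = (if i \<le> j then False # path l i else True # path r i)"

text \<open>Equal keys leave the choice of the root open; the redundancy bound holds for every
  choice.\<close>

fun cartesian :: "(nat \<Rightarrow> real) \<Rightarrow> nat \<Rightarrow> nat \<Rightarrow> gap_tree \<Rightarrow> bool" where
  "cartesian Y a b (Leaf i) \<longleftrightarrow> a = i \<and> b = i"
| "cartesian Y a b (Node l j r) \<longleftrightarrow> a \<le> j \<and> j < b \<and> (\<forall>k\<in>{a..<b}. Y k \<le> Y j) \<and>
     cartesian Y a j l \<and> cartesian Y (Suc j) b r"

lemma cartesian_le: "cartesian Y a b t \<Longrightarrow> a \<le> b"
  by (cases t) auto

lemma path_lexord:
  "cartesian Y a b t \<Longrightarrow> a \<le> i \<Longrightarrow> i < k \<Longrightarrow> k \<le> b \<Longrightarrow>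
    (path t i, path t k) \<in> lexord {(False, True)}"
  by (induction t arbitrary: a b) auto

lemma path_not_prefix:
  "cartesian Y a b t \<Longrightarrow> i \<in> {a..b} \<Longrightarrow> k \<in> {a..b} \<Longrightarrow> i \<noteq> k \<Longrightarrow>
    \<not> prefix (path t i) (path t k)"
proof (induction t arbitrary: a b)
  case (Node l j r)
  then show ?case
    using Node.IH(1)[of a j] Node.IH(2)[of "Suc j" b] by auto
qed auto

lemma alphabetic_code_path:
  assumes "cartesian Y 1 m t" "2 \<le> m"
  shows "alphabetic_code m (path t)"
proof -
  have "path t i \<noteq> []" for i using assms by (cases t) auto
  then show ?thesis
    using path_lexord[OF assms(1)] path_not_prefix[OF assms(1)]
    unfolding alphabetic_code_def by auto
qed

section \<open>Redundancy of the contracted trie of midpoints\<close>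

lemma pow2_mult_less_iff:
  fixes p :: real
  assumes "0 < p"
  shows "2 ^ d * p < 2 ^ k \<longleftrightarrow> real d < real k - log 2 p"
proof -
  have "2 ^ d * p < 2 ^ k \<longleftrightarrow> log 2 (2 ^ d * p) < log 2 (2 ^ k)"
    using assms by (subst log_less_cancel_iff) auto
  also have "\<dots> \<longleftrightarrow> real d + log 2 p < real k"
    using assms by (simp add: log_mult log_nat_power)
  finally show ?thesis by linarith
qed

lemma pow2_mult_le_iff:
  fixes p :: real
  assumes "0 < p"
  shows "2 ^ d * p \<le> 2 ^ k \<longleftrightarrow> real d \<le> real k - log 2 p"
proof -
  have "2 ^ d * p \<le> 2 ^ k \<longleftrightarrow> log 2 (2 ^ d * p) \<le> log 2 (2 ^ k)"
    using assms by (subst log_le_cancel_iff) auto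
  also have "\<dots> \<longleftrightarrow> real d + log 2 p \<le> real k"
    using assms by (simp add: log_mult log_nat_power)
  finally show ?thesis by linarith
qed

locale distribution =
  fixes m :: nat and \<phi> :: "nat \<Rightarrow> real"
  assumes m_ge: "2 \<le> m"
    and nonneg: "i \<in> {1..m} \<Longrightarrow> 0 \<le> \<phi> i"
    and sum_one: "(\<Sum>i=1..m. \<phi> i) = 1"
    and pos: "0 < \<phi> 1" "0 < \<phi> 2" "0 < \<phi> (m - 1)" "0 < \<phi> m"
    and not_half: "\<not> (m = 2 \<and> \<phi> 1 = 1 / 2)"
begin

definition cum :: "nat \<Rightarrow> real" where
  "cum i = (\<Sum>k=1..i. \<phi> k)"

text \<open>The case distinction makes \<open>mid (Suc m)\<close> the sentinel 1 whatever
  \<open>\<phi>\<close> is beyond \<open>m\<close>; the input array is 0 there as well.\<close>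

definition mid :: "nat \<Rightarrow> real" where
  "mid i = cum (i - 1) + (if i \<le> m then \<phi> i / 2 else 0)"

definition key :: "nat \<Rightarrow> real" where
  "key i = split_key (mid i) (mid (Suc i))"

definition prefix_of :: "nat \<Rightarrow> nat \<Rightarrow> int" where
  "prefix_of d i = \<lfloor>2 ^ d * mid i\<rfloor>"

text \<open>The length budget of a symbol; the caps at the outer symbols become the two
  \<open>max\<close> terms of the bound.\<close>

definition len :: "nat \<Rightarrow> int" where
  "len i =
    (if i = 1 then min \<lceil>- log 2 (\<phi> 1)\<rceil> (\<lceil>- log 2 (\<phi> 2)\<rceil> + 2)
     else if i = m then min \<lceil>- log 2 (\<phi> m)\<rceil> (\<lceil>- log 2 (\<phi> (m - 1))\<rceil> + 2)
     else \<lfloor>- log 2 (\<phi> i)\<rfloor> + 2)"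

text \<open>Whether symbol \<open>i\<close> has no mass to the left (right) of the dyadic interval of level \<open>d\<close> that
  contains its midpoint. A symbol pays for the gap on such a side. The outer symbols get strict
  inequalities because their codewords are about one bit shorter.\<close>

definition lfree :: "nat \<Rightarrow> nat \<Rightarrow> bool" where
  "lfree d i \<longleftrightarrow> i \<noteq> 1 \<and>
    (if i = m then of_int (prefix_of d i) < 2 ^ d * cum (i - 1)
     else of_int (prefix_of d i) \<le> 2 ^ d * cum (i - 1))"

definition rfree :: "nat \<Rightarrow> nat \<Rightarrow> bool" where
  "rfree d i \<longleftrightarrow> i \<noteq> m \<and>
    (if i = 1 then 2 ^ d * cum i < of_int (prefix_of d i) + 1
     else 2 ^ d * cum i \<le> of_int (prefix_of d i) + 1)"

section \<open>Order of midpoints, prefixes and keys\<close>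

lemma cum_simps: "cum 0 = 0" "cum (Suc i) = cum i + \<phi> (Suc i)" "cum m = 1"
  using sum_one by (auto simp: cum_def)

lemma cum_diff: "1 \<le> i \<Longrightarrow> cum i = cum (i - 1) + \<phi> i"
  using cum_simps(2)[of "i - 1"] by simp

lemma cum_mono: "i \<le> j \<Longrightarrow> j \<le> m \<Longrightarrow> cum i \<le> cum j"
  unfolding cum_def by (rule sum_mono2) (auto intro!: nonneg)

lemma mid_eq: "1 \<le> i \<Longrightarrow> i \<le> m \<Longrightarrow> mid i = cum (i - 1) + \<phi> i / 2"
  by (simp add: mid_def)

lemma mid_eq': "1 \<le> i \<Longrightarrow> i \<le> m \<Longrightarrow> mid i = cum i - \<phi> i / 2"
  using cum_diff[of i] by (simp add: mid_def)

lemma mid_gap: "1 \<le> i \<Longrightarrow> i < j \<Longrightarrow> j \<le> m \<Longrightarrow> \<phi> i / 2 + \<phi> j / 2 \<le> mid j - mid i"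
  using mid_eq[of j] mid_eq'[of i] cum_mono[of i "j - 1"] by simp

lemma mid_mono: "1 \<le> i \<Longrightarrow> i \<le> j \<Longrightarrow> j \<le> m \<Longrightarrow> mid i \<le> mid j"
  using mid_gap[of i j] nonneg[of i] nonneg[of j] by (cases "i = j") auto

lemma mid_bounds: assumes "1 \<le> i" "i \<le> m" shows "0 < mid i" "mid i < 1"
proof -
  have "mid 1 > 0" "mid m < 1"
    using mid_eq[of 1] mid_eq'[of m] m_ge pos cum_simps by auto
  then show "0 < mid i" "mid i < 1"
    using mid_mono[of 1 i] mid_mono[of i m] assms m_ge by auto
qed

lemma key_last: "key m = 2"
proof -
  have "mid (Suc m) = 1" by (simp add: mid_def cum_simps)
  then show ?thesis
    using split_key_one mid_bounds[of m] m_ge by (simp add: key_def)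
qed

lemma prefix_mono: "1 \<le> i \<Longrightarrow> i \<le> j \<Longrightarrow> j \<le> m \<Longrightarrow> prefix_of d i \<le> prefix_of d j"
  unfolding prefix_of_def by (intro floor_mono mult_left_mono mid_mono) auto

lemma prefix_Suc: "prefix_of (Suc d) i = 2 * prefix_of d i \<or> prefix_of (Suc d) i = 2 * prefix_of d i + 1"
  unfolding prefix_of_def power_Suc mult.assoc by linarith

lemma prefix_eq_mono: "prefix_of n i = prefix_of n j \<Longrightarrow> d \<le> n \<Longrightarrow> prefix_of d i = prefix_of d j"
  unfolding prefix_of_def by (rule floor_pow_eq_mono)

lemma prefix_eqD:
  assumes "prefix_of d i = prefix_of d j"
  shows "2 ^ d * (mid j - mid i) < 1"
proof -
  have "2 ^ d * mid j - 2 ^ d * mid i < 1"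
    using assms unfolding prefix_of_def by linarith
  then show ?thesis by (simp add: right_diff_distrib)
qed

lemma key_less:
  assumes "1 \<le> i" "i < m" "prefix_of n i = prefix_of n (Suc i)"
  shows "key i < 2 / 2 ^ n"
  using assms mid_bounds[of i] mid_bounds[of "Suc i"] unfolding key_def prefix_of_def
  by (intro split_key_less) auto

lemma key_ge:
  assumes "1 \<le> i" "i < m" "prefix_of n i = prefix_of n (Suc i)"
    "prefix_of (Suc n) i \<noteq> prefix_of (Suc n) (Suc i)"
  shows "1 / 2 ^ n \<le> key i"
proof -
  have "prefix_of (Suc n) i < prefix_of (Suc n) (Suc i)"
    using assms prefix_mono[of i "Suc i" "Suc n"] by simp
  then show ?thesis
    using assms mid_bounds[of i] mid_bounds[of "Suc i"] unfolding key_def prefix_of_def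
    by (intro split_key_ge) auto
qed

lemma key_less_two: assumes "1 \<le> i" "i < m" shows "key i < 2"
proof -
  have "prefix_of 0 k = 0" if "k \<in> {1..m}" for k
    using mid_bounds[of k] that by (simp add: prefix_of_def floor_eq_iff)
  then show ?thesis using key_less[of i 0] assms by simp
qed

section \<open>Payment for gaps and depth bounds for single symbols\<close>

lemma lfree_Suc: "prefix_of (Suc d) i = 2 * prefix_of d i \<Longrightarrow> lfree (Suc d) i \<longleftrightarrow> lfree d i"
  unfolding lfree_def power_Suc mult.assoc by auto

text \<open>The right half of a dyadic interval keeps its right end, as the left half keeps its left
  end in \<open>lfree_Suc\<close>.\<close>

lemma rfree_Suc: "prefix_of (Suc d) i = 2 * prefix_of d i + 1 \<Longrightarrow> rfree (Suc d) i \<longleftrightarrow> rfree d i"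
  unfolding rfree_def power_Suc mult.assoc by auto

text \<open>The split point is the right end of the interval of \<open>j\<close> and the left end of
  that of \<open>Suc j\<close>. If neither symbol were free there, \<open>cum j\<close> would lie on
  both sides of it, up to equality.\<close>

lemma gap_free:
  assumes "1 \<le> j" "j < m" "prefix_of d j = prefix_of d (Suc j)"
    and ne: "prefix_of (Suc d) j \<noteq> prefix_of (Suc d) (Suc j)"
  shows "rfree (Suc d) j \<or> lfree (Suc d) (Suc j)"
proof -
  have q: "prefix_of (Suc d) j = 2 * prefix_of d j"
    "prefix_of (Suc d) (Suc j) = 2 * prefix_of d j + 1"
    using prefix_Suc[of d j] prefix_Suc[of d "Suc j"] assms prefix_mono[of j "Suc j" "Suc d"]
    by auto
  show ?thesis
  proof (cases "m = 2")
    case True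
    then have j: "j = 1" using assms by simp
    have \<phi>2: "\<phi> 2 = 1 - \<phi> 1" using cum_simps True by (simp add: numeral_2_eq_2)
    have mids: "mid 1 = \<phi> 1 / 2" "mid 2 = 1 / 2 + \<phi> 1 / 2"
      using mid_eq[of 1] mid_eq'[of 2] True cum_simps \<phi>2 by (auto simp: field_simps)
    \<comment> \<open>The first digits differ, so \<open>d = 0\<close> and the split point is 1/2.
      Both conditions are strict here and fail together only for \<open>cum 1 = 1 / 2\<close>, which
      \<open>not_half\<close> excludes.\<close>
    have "prefix_of 1 1 = 0" "prefix_of 1 2 = 1"
      using mids pos \<phi>2 by (auto simp: prefix_of_def floor_eq_iff)
    then have "d = 0"
      using prefix_eq_mono[of d 1 2 1] assms j by (cases d) (auto simp: numeral_2_eq_2)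
    then have p: "prefix_of 1 1 = 0" "prefix_of 1 2 = 1"
      using \<open>prefix_of 1 1 = 0\<close> \<open>prefix_of 1 2 = 1\<close> by auto
    have "cum 1 = \<phi> 1" by (simp add: cum_def)
    then have "2 * cum 1 < 1 \<or> 1 < 2 * cum 1" using not_half True by auto
    moreover have "rfree 1 1 \<longleftrightarrow> 2 * cum 1 < 1"
      using p m_ge unfolding rfree_def by auto
    moreover have "lfree 1 2 \<longleftrightarrow> 1 < 2 * cum 1"
      using p unfolding lfree_def if_P[OF True[symmetric]] by auto
    ultimately show ?thesis
      using j \<open>d = 0\<close> by (auto simp: numeral_2_eq_2)
  next
    case False
    \<comment> \<open>\<open>j = 1\<close> and \<open>Suc j = m\<close> cannot both hold, so at most
      one of the two conditions is strict and they cannot fail together.\<close>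
    show ?thesis
      using q assms m_ge False unfolding rfree_def lfree_def by auto
  qed
qed

text \<open>The mass of symbol 1 starts at 0, so the common interval of level \<open>d\<close> is
  the first one, and it contains all of \<open>\<phi> 1\<close>. A second bound comes from
  \<open>\<phi> 2\<close>, half of which separates the two midpoints.\<close>

lemma len_first:
  assumes shared: "prefix_of d 1 = prefix_of d 2"
  shows "int (Suc d) + of_bool (rfree (Suc d) 1) \<le> len 1"
proof -
  have cum1: "cum 1 = \<phi> 1" by (simp add: cum_def)
  have mids: "mid 1 = \<phi> 1 / 2" "\<phi> 1 < mid 2" "\<phi> 1 / 2 + \<phi> 2 / 2 \<le> mid 2 - mid 1"
    using mid_eq[of 1] mid_eq[of 2] mid_gap[of 1 2] m_ge pos cum_simps(1) cum1 by auto
  have near: "2 ^ d * (mid 2 - mid 1) < 1" using shared by (rule prefix_eqD)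
  have "2 ^ d * (\<phi> 2 / 2) < 1"
    by (rule le_less_trans[OF mult_left_mono near]) (use mids pos in auto)
  then have "2 ^ Suc d * \<phi> 2 < 2 ^ 2" by (simp add: mult.commute)
  then have "real (Suc d) < 2 - log 2 (\<phi> 2)" using pos by (subst (asm) pow2_mult_less_iff) auto
  \<comment> \<open>Strictness yields an extra unit, so this bound covers the charge for the right
    gap whether it is due or not.\<close>
  then have b2: "int (Suc d) + 1 \<le> \<lceil>- log 2 (\<phi> 2)\<rceil> + 2" by linarith
  have "2 ^ d * (\<phi> 1 / 2) < 1"
    by (rule le_less_trans[OF mult_left_mono near]) (use mids pos in auto)
  then have "2 ^ d * mid 1 < 1" unfolding mids(1) .
  then have "prefix_of d 1 = 0"
    using mid_bounds[of 1] m_ge by (simp add: prefix_of_def floor_eq_iff)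
  then have "2 ^ d * mid 2 < 1"
    using shared unfolding prefix_of_def by linarith
  moreover have "2 ^ d * \<phi> 1 < 2 ^ d * mid 2" using mids by simp
  ultimately have "2 ^ d * \<phi> 1 < 1" by linarith
  then have "2 ^ Suc d * \<phi> 1 < 2 ^ 1" by simp
  then have "real (Suc d) < 1 - log 2 (\<phi> 1)" using pos by (subst (asm) pow2_mult_less_iff) auto
  then have b1: "int (Suc d) \<le> \<lceil>- log 2 (\<phi> 1)\<rceil>" by linarith
  \<comment> \<open>Strict freeness is needed: \<open>2 ^ Suc d * \<phi> 1 = 1\<close> would give
    \<open>- log 2 (\<phi> 1) = Suc d\<close> and no extra unit in the ceiling.\<close>
  have "int (Suc d) + 1 \<le> \<lceil>- log 2 (\<phi> 1)\<rceil>" if "rfree (Suc d) 1"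
  proof -
    let ?y = "2 ^ Suc d * \<phi> 1"
    have "prefix_of (Suc d) 1 = \<lfloor>?y / 2\<rfloor>" unfolding prefix_of_def mids(1) by simp
    then have y: "?y < of_int \<lfloor>?y / 2\<rfloor> + 1"
      using that cum1 unfolding rfree_def by auto
    then have "?y / 2 < 1" by linarith
    moreover have "0 < ?y / 2" using pos by simp
    ultimately have "\<lfloor>?y / 2\<rfloor> = 0" by linarith
    with y have "?y < 2 ^ 0" by simp
    then have "real (Suc d) < 0 - log 2 (\<phi> 1)" using pos by (subst (asm) pow2_mult_less_iff) auto
    then show ?thesis by linarith
  qed
  with b1 b2 show ?thesis by (auto simp: len_def)
qed

text \<open>Mirror image of \<open>len_first\<close> at the right end of the unit interval, with
  common prefix \<open>2 ^ d - 1\<close> instead of 0.\<close>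

lemma len_last:
  assumes shared: "prefix_of d (m - 1) = prefix_of d m"
  shows "int (Suc d) + of_bool (lfree (Suc d) m) \<le> len m"
proof -
  have cumm: "cum (m - 1) = 1 - \<phi> m" using cum_diff[of m] cum_simps m_ge by simp
  have mids: "mid m = 1 - \<phi> m / 2" "mid (m - 1) < 1 - \<phi> m"
      "\<phi> (m - 1) / 2 + \<phi> m / 2 \<le> mid m - mid (m - 1)"
    using mid_eq'[of m] mid_eq'[of "m - 1"] mid_gap[of "m - 1" m] m_ge pos cum_simps(3) cumm
    by auto
  have near: "2 ^ d * (mid m - mid (m - 1)) < 1" using shared by (rule prefix_eqD)
  have "2 ^ d * (\<phi> (m - 1) / 2) < 1"
    by (rule le_less_trans[OF mult_left_mono near]) (use mids pos in auto)
  then have "2 ^ Suc d * \<phi> (m - 1) < 2 ^ 2" by (simp add: mult.commute)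
  then have "real (Suc d) < 2 - log 2 (\<phi> (m - 1))"
    using pos by (subst (asm) pow2_mult_less_iff) auto
  then have b2: "int (Suc d) + 1 \<le> \<lceil>- log 2 (\<phi> (m - 1))\<rceil> + 2" by linarith
  have below: "\<lfloor>2 ^ n - y / 2\<rfloor> = 2 ^ n - 1" if "0 < y" "y / 2 < 1" for n and y :: real
    using that by (simp add: floor_eq_iff)
  have "2 ^ d * (\<phi> m / 2) < 1"
    by (rule le_less_trans[OF mult_left_mono near]) (use mids pos in auto)
  then have "prefix_of d m = 2 ^ d - 1"
    using below[of "2 ^ d * \<phi> m" d] mids pos by (simp add: prefix_of_def right_diff_distrib)
  then have "2 ^ d - 1 = \<lfloor>2 ^ d * mid (m - 1)\<rfloor>"
    using shared unfolding prefix_of_def by simp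
  then have "2 ^ d - 1 \<le> 2 ^ d * mid (m - 1)"
    by (metis of_int_1 of_int_diff of_int_floor_le of_int_numeral of_int_power)
  moreover have "2 ^ d * mid (m - 1) < 2 ^ d * (1 - \<phi> m)" using mids by simp
  ultimately have "2 ^ Suc d * \<phi> m < 2 ^ 1" by (simp add: right_diff_distrib)
  then have "real (Suc d) < 1 - log 2 (\<phi> m)" using pos by (subst (asm) pow2_mult_less_iff) auto
  then have b1: "int (Suc d) \<le> \<lceil>- log 2 (\<phi> m)\<rceil>" by linarith
  have "int (Suc d) + 1 \<le> \<lceil>- log 2 (\<phi> m)\<rceil>" if "lfree (Suc d) m"
  proof -
    let ?y = "2 ^ Suc d * \<phi> m"
    have p: "prefix_of (Suc d) m = \<lfloor>2 ^ Suc d - ?y / 2\<rfloor>"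
      using mids(1) by (simp add: prefix_of_def right_diff_distrib)
    have y: "of_int \<lfloor>2 ^ Suc d - ?y / 2\<rfloor> < 2 ^ Suc d - ?y"
      using that cumm unfolding lfree_def p by (simp add: right_diff_distrib)
    then have "?y / 2 < 1" by linarith
    moreover have "0 < ?y" using pos by simp
    ultimately have "\<lfloor>2 ^ Suc d - ?y / 2\<rfloor> = 2 ^ Suc d - 1" by (intro below)
    with y have "?y < 2 ^ 0" by simp
    then have "real (Suc d) < 0 - log 2 (\<phi> m)" using pos by (subst (asm) pow2_mult_less_iff) auto
    then show ?thesis by linarith
  qed
  with b1 b2 show ?thesis using m_ge by (auto simp: len_def)
qed

text \<open>Free on both sides: the whole mass fits into the interval of level \<open>Suc d\<close>.
  Free on one side: half of it does. Free on neither: half of it fits between two midpoints in a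
  common interval of level \<open>d\<close>. Each case weakens the bound on \<open>\<phi> i\<close>
  by a factor 2, that is, one bit.\<close>

lemma len_inner:
  assumes i: "1 < i" "i < m" and pos_i: "0 < \<phi> i"
    and j: "j \<in> {1..m}" "j \<noteq> i" and shared: "prefix_of d i = prefix_of d j"
  shows "int (Suc d) + of_bool (lfree (Suc d) i) + of_bool (rfree (Suc d) i) \<le> len i"
proof -
  let ?x = "- log 2 (\<phi> i)" and ?q = "prefix_of (Suc d) i"
  have len: "len i = \<lfloor>?x\<rfloor> + 2" using i by (simp add: len_def)
  have q: "of_int ?q \<le> 2 ^ Suc d * mid i" "2 ^ Suc d * mid i < of_int ?q + 1"
    unfolding prefix_of_def by linarith+
  have mids: "mid i = cum (i - 1) + \<phi> i / 2" "mid i = cum i - \<phi> i / 2"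
    using mid_eq[of i] mid_eq'[of i] i by auto
  have half: "\<phi> i / 2 = mid i - cum (i - 1)" "\<phi> i / 2 = cum i - mid i" using mids by auto
  have l: "2 ^ Suc d * (\<phi> i / 2) \<le> 2 ^ Suc d * mid i - of_int ?q" if "lfree (Suc d) i"
    using that i unfolding lfree_def half(1) right_diff_distrib by simp
  have r: "2 ^ Suc d * (\<phi> i / 2) \<le> of_int ?q + 1 - 2 ^ Suc d * mid i" if "rfree (Suc d) i"
    using that i unfolding rfree_def half(2) right_diff_distrib by simp
  consider "lfree (Suc d) i" "rfree (Suc d) i" | "lfree (Suc d) i \<noteq> rfree (Suc d) i"
    | "\<not> lfree (Suc d) i" "\<not> rfree (Suc d) i" by blast
  then show ?thesis
  proof cases
    case 1
    then have "2 ^ Suc d * (\<phi> i / 2) + 2 ^ Suc d * (\<phi> i / 2) \<le> 1" using l r by linarith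
    then have "2 ^ Suc d * \<phi> i \<le> 2 ^ 0" by (simp add: field_simps)
    then have "real (Suc d) \<le> 0 + ?x" using pos_i by (subst (asm) pow2_mult_le_iff) auto
    with 1 show ?thesis unfolding len by (simp; linarith)
  next
    case 2
    then have "2 ^ Suc d * (\<phi> i / 2) \<le> 1" using l r q by linarith
    then have "2 ^ Suc d * \<phi> i \<le> 2 ^ 1" by (simp add: mult.commute)
    then have "real (Suc d) \<le> 1 + ?x" using pos_i by (subst (asm) pow2_mult_le_iff) auto
    then have "int (Suc d) + 1 \<le> \<lfloor>?x\<rfloor> + 2" by linarith
    with 2 show ?thesis unfolding len by auto
  next
    case 3
    have "\<phi> i / 2 \<le> mid j - mid i \<or> \<phi> i / 2 \<le> mid i - mid j"
      using mid_gap[of i j] mid_gap[of j i] i j nonneg[of j] by (cases "i < j") auto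
    then have "\<phi> i / 2 \<le> \<bar>mid j - mid i\<bar>" by linarith
    moreover have "2 ^ d * \<bar>mid j - mid i\<bar> < 1"
      using prefix_eqD[OF shared] prefix_eqD[OF shared[symmetric]] by (auto simp: abs_if)
    ultimately have "2 ^ d * (\<phi> i / 2) < 1"
      by (meson le_less_trans mult_left_mono zero_le_numeral zero_le_power)
    then have "2 ^ Suc d * \<phi> i \<le> 2 ^ 2" by (simp add: mult.commute)
    then have "real (Suc d) \<le> 2 + ?x" using pos_i by (subst (asm) pow2_mult_le_iff) auto
    then have "int (Suc d) \<le> \<lfloor>?x\<rfloor> + 2" by linarith
    with 3 show ?thesis unfolding len by simp
  qed
qed

text \<open>Prefixes are monotone, so an outer symbol that shares its prefix with any
  \<open>j\<close> also shares it with its neighbour.\<close>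

lemma len_ge:
  assumes "i \<in> {1..m}" "0 < \<phi> i" "j \<in> {1..m}" "j \<noteq> i" and shared: "prefix_of d i = prefix_of d j"
  shows "int (Suc d) + of_bool (lfree (Suc d) i) + of_bool (rfree (Suc d) i) \<le> len i"
proof -
  consider "i = 1" | "i = m" "i \<noteq> 1" | "1 < i" "i < m" using assms by fastforce
  then show ?thesis
  proof cases
    case 1
    have "prefix_of d 1 = prefix_of d 2"
      using 1 assms prefix_mono[of 1 2 d] prefix_mono[of 2 j d] m_ge by auto
    with 1 show ?thesis using len_first[of d] by (simp add: lfree_def)
  next
    case 2
    have "j \<le> m - 1" using 2 assms by auto
    then have "prefix_of d (m - 1) = prefix_of d m"
      using 2 assms prefix_mono[of "m - 1" m d] prefix_mono[of j "m - 1" d] m_ge by auto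
    with 2 show ?thesis using len_last[of d] by (simp add: rfree_def)
  next
    case 3
    then show ?thesis using len_inner assms by blast
  qed
qed

section \<open>Sums over ranges of leaves and induction over the tree\<close>

definition mass :: "nat \<Rightarrow> nat \<Rightarrow> real" where
  "mass a b = (\<Sum>i=a..b. \<phi> i)"

definition path_cost :: "gap_tree \<Rightarrow> nat \<Rightarrow> nat \<Rightarrow> real" where
  "path_cost t a b = (\<Sum>i=a..b. \<phi> i * real (length (path t i)))"

definition min_sum :: "nat \<Rightarrow> nat \<Rightarrow> real" where
  "min_sum a b = (\<Sum>i=a..<b. min (\<phi> i) (\<phi> (Suc i)))"

text \<open>The weighted length budget that remains below level \<open>d\<close>.\<close>

definition len_cost :: "nat \<Rightarrow> nat \<Rightarrow> nat \<Rightarrow> real" where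
  "len_cost d a b = (\<Sum>i=a..b. \<phi> i * (of_int (len i) - real d))"

lemma sum_split: "a \<le> j \<Longrightarrow> j < b \<Longrightarrow> (\<Sum>i=a..b. f i) = (\<Sum>i=a..j. f i) + (\<Sum>i=Suc j..b. f i)"
  for f :: "nat \<Rightarrow> real"
  using sum.ub_add_nat[of a j f "b - j"] by simp

lemma min_sum_split:
  "a \<le> j \<Longrightarrow> j < b \<Longrightarrow>
    min_sum a b = min_sum a j + min (\<phi> j) (\<phi> (Suc j)) + min_sum (Suc j) b"
  using sum.atLeastLessThan_concat[of a j b "\<lambda>i. min (\<phi> i) (\<phi> (Suc i))"]
    sum.atLeast_Suc_lessThan[of j b "\<lambda>i. min (\<phi> i) (\<phi> (Suc i))"]
  by (simp add: min_sum_def)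

lemma path_cost_Node:
  assumes "a \<le> j" "j < b"
  shows "path_cost (Node l j r) a b = mass a b + path_cost l a j + path_cost r (Suc j) b"
  unfolding path_cost_def mass_def sum_split[OF assms]
  by (simp add: sum.distrib algebra_simps)

lemma len_cost_split:
  "a \<le> j \<Longrightarrow> j < b \<Longrightarrow> len_cost d a b = len_cost d a j + len_cost d (Suc j) b"
  unfolding len_cost_def by (rule sum_split)

lemma len_cost_shift: "len_cost (d + e) a b = len_cost d a b - real e * mass a b"
  unfolding len_cost_def mass_def sum_distrib_left sum_subtractf[symmetric]
  by (intro sum.cong) (auto simp: algebra_simps)

lemma mass_ge_ends:
  assumes "1 \<le> a" "a < b" "b \<le> m"
  shows "\<phi> a + \<phi> b \<le> mass a b"
proof -
  have "sum \<phi> {a, b} \<le> sum \<phi> {a..b}"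
    using assms by (intro sum_mono2) (auto intro: nonneg)
  then show ?thesis using assms by (simp add: mass_def)
qed

text \<open>Positive mass separates the midpoints of \<open>a\<close> and \<open>b\<close>, so their
  prefixes differ eventually; \<open>e\<close> is the last level of agreement.\<close>

lemma split_level:
  assumes "1 \<le> a" "a < b" "b \<le> m" "\<exists>i\<in>{a..b}. 0 < \<phi> i"
    and shared: "prefix_of d a = prefix_of d b"
  obtains e where "d \<le> e" "prefix_of e a = prefix_of e b" "prefix_of (Suc e) a \<noteq> prefix_of (Suc e) b"
proof -
  have lt: "mid a < mid b"
  proof -
    obtain i where i: "i \<in> {a..b}" "0 < \<phi> i" using assms(4) by blast
    show ?thesis
    proof (cases "i = a")
      case True
      then show ?thesis using mid_gap[of a b] nonneg[of b] i assms by auto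
    next
      case False
      then have "mid a < mid i" using mid_gap[of a i] nonneg[of a] i assms by auto
      then show ?thesis using mid_mono[of i b] i assms by auto
    qed
  qed
  let ?P = "\<lambda>n. prefix_of n a \<noteq> prefix_of n b"
  obtain n where "1 / (mid b - mid a) < 2 ^ n" using real_arch_pow[of 2] by auto
  then have "1 < 2 ^ n * (mid b - mid a)" using lt by (simp add: pos_divide_less_eq)
  then have "?P n" using prefix_eqD[of n a b] by auto
  define N where "N = (LEAST n. ?P n)"
  have N: "?P N" unfolding N_def using \<open>?P n\<close> by (rule LeastI)
  then have "d < N" using shared prefix_eq_mono[of d a b N] by (metis not_less prefix_eq_mono)
  moreover have "\<not> ?P (N - 1)"
    using \<open>d < N\<close> unfolding N_def by (intro not_less_Least) auto
  ultimately show thesis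
    using that[of "N - 1"] N by auto
qed

text \<open>Some neighbours in the range separate at level \<open>Suc e\<close> and have a key of at
  least \<open>1 / 2 ^ e\<close>; the maximal key at the root is thus too large for a later
  separation. By monotonicity the leaves up to \<open>j\<close> lie in the left half and the others
  in the right half.\<close>

lemma root_splits:
  assumes "cartesian key a b (Node l j r)" "1 \<le> a" "b \<le> m"
    and eq: "prefix_of e a = prefix_of e b" and ne: "prefix_of (Suc e) a \<noteq> prefix_of (Suc e) b"
  shows "prefix_of (Suc e) a = prefix_of (Suc e) j"
    "prefix_of (Suc e) (Suc j) = prefix_of (Suc e) b"
    "prefix_of (Suc e) a = 2 * prefix_of e a"
    "prefix_of (Suc e) b = 2 * prefix_of e b + 1"
    "prefix_of (Suc e) j \<noteq> prefix_of (Suc e) (Suc j)"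
    "prefix_of e j = prefix_of e (Suc j)"
proof -
  have j: "a \<le> j" "j < b" and top: "\<And>k. k \<in> {a..<b} \<Longrightarrow> key k \<le> key j"
    using assms(1) by auto
  have mono: "prefix_of n i \<le> prefix_of n k" if "a \<le> i" "i \<le> k" "k \<le> b" for n i k
    using prefix_mono[of i k n] that assms by simp
  have "\<exists>k\<in>{a..<b}. prefix_of (Suc e) k \<noteq> prefix_of (Suc e) (Suc k)"
  proof (rule ccontr)
    assume "\<not> ?thesis"
    then have "prefix_of (Suc e) (a + k) = prefix_of (Suc e) a" if "a + k \<le> b" for k
      using that by (induction k) auto
    from this[of "b - a"] show False using ne j by auto
  qed
  then obtain k where k: "a \<le> k" "k < b" "prefix_of (Suc e) k \<noteq> prefix_of (Suc e) (Suc k)"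
    by auto
  have same: "prefix_of e i = prefix_of e a" if "a \<le> i" "i \<le> b" for i
    using mono[of a i e] mono[of i b e] that eq by auto
  have "1 / 2 ^ e \<le> key k"
    by (rule key_ge) (use k same[of k] same[of "Suc k"] assms in auto)
  also have "\<dots> \<le> key j" using top k by auto
  finally have large: "1 / 2 ^ e \<le> key j" .
  show nej: "prefix_of (Suc e) j \<noteq> prefix_of (Suc e) (Suc j)"
  proof
    assume "prefix_of (Suc e) j = prefix_of (Suc e) (Suc j)"
    then have "key j < 2 / 2 ^ Suc e"
      by (intro key_less) (use j assms in auto)
    with large show False by simp
  qed
  show "prefix_of e j = prefix_of e (Suc j)" using same[of j] same[of "Suc j"] j by simp
  have ord: "prefix_of (Suc e) a \<le> prefix_of (Suc e) j"
    "prefix_of (Suc e) j < prefix_of (Suc e) (Suc j)"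
    "prefix_of (Suc e) (Suc j) \<le> prefix_of (Suc e) b"
    using mono[of a j "Suc e"] mono[of j "Suc j" "Suc e"] mono[of "Suc j" b "Suc e"] nej j
    by auto
  then show "prefix_of (Suc e) a = prefix_of (Suc e) j"
    "prefix_of (Suc e) (Suc j) = prefix_of (Suc e) b"
    "prefix_of (Suc e) a = 2 * prefix_of e a"
    "prefix_of (Suc e) b = 2 * prefix_of e b + 1"
    using prefix_Suc[of e a] prefix_Suc[of e b] eq by auto
qed

text \<open>The induction hypotheses of the two subtrees together pay for the root gap, because its
  split point cannot lie strictly inside the mass of both neighbouring symbols.\<close>

lemma path_cost_le:
  assumes "cartesian key a b t" "1 \<le> a" "b \<le> m" "prefix_of d a = prefix_of d b"
    and "a = b \<Longrightarrow> \<exists>d' j. d = Suc d' \<and> j \<in> {1..m} \<and> j \<noteq> a \<and> prefix_of d' a = prefix_of d' j"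
  shows "path_cost t a b + min_sum a b + of_bool (lfree d a) * \<phi> a + of_bool (rfree d b) * \<phi> b
    \<le> len_cost d a b"
  using assms
proof (induction t arbitrary: a b d)
  case (Leaf i)
  then have [simp]: "b = a" by simp
  obtain d' j where d': "d = Suc d'" "j \<in> {1..m}" "j \<noteq> a" "prefix_of d' a = prefix_of d' j"
    using Leaf.prems(5) by auto
  \<comment> \<open>The depth bound needs positive mass; without mass both sides vanish.\<close>
  have "(of_bool (lfree d a) + of_bool (rfree d a)) * \<phi> a \<le> (of_int (len a) - real d) * \<phi> a"
  proof (cases "\<phi> a = 0")
    case False
    then have "int d + of_bool (lfree d a) + of_bool (rfree d a) \<le> len a"
      using len_ge[of a j d'] nonneg[of a] Leaf.prems d' by auto
    then have "real_of_int (int d + of_bool (lfree d a) + of_bool (rfree d a)) \<le> of_int (len a)"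
      by (simp only: of_int_le_iff)
    then show ?thesis
      using nonneg[of a] Leaf.prems by (intro mult_right_mono) (auto split: if_splits)
  qed simp
  then show ?case
    by (simp add: path_cost_def min_sum_def len_cost_def algebra_simps)
next
  case (Node l j r)
  have j: "a \<le> j" "j < b" and sub: "cartesian key a j l" "cartesian key (Suc j) b r"
    using Node.prems(1) by auto
  show ?case
  \<comment> \<open>Without mass the midpoints coincide and no split level exists, but all terms
    vanish.\<close>
  proof (cases "\<exists>i\<in>{a..b}. 0 < \<phi> i")
    case False
    then have z: "\<phi> i = 0" if "i \<in> {a..b}" for i
      using nonneg[of i] that Node.prems by (metis atLeastAtMost_iff le_trans less_eq_real_def)
    then have "path_cost (Node l j r) a b = 0" "min_sum a b = 0" "len_cost d a b = 0"
      "\<phi> a = 0" "\<phi> b = 0"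
      using j unfolding path_cost_def min_sum_def len_cost_def by auto
    then show ?thesis by simp
  next
    case True
    obtain e where e: "d \<le> e" "prefix_of e a = prefix_of e b"
      "prefix_of (Suc e) a \<noteq> prefix_of (Suc e) b"
      using split_level[of a b d] True Node.prems j by auto
    note split = root_splits[OF Node.prems(1-3) e(2,3)]
    \<comment> \<open>If a subtree is a single leaf, the opposite end of the range is the other
      symbol with the same prefix at level \<open>e\<close>.\<close>
    have l: "path_cost l a j + min_sum a j + of_bool (lfree (Suc e) a) * \<phi> a
        + of_bool (rfree (Suc e) j) * \<phi> j \<le> len_cost (Suc e) a j"
      by (rule Node.IH(1)[OF sub(1)]) (use split e j Node.prems in \<open>auto intro!: exI[of _ b]\<close>)
    have r: "path_cost r (Suc j) b + min_sum (Suc j) b + of_bool (lfree (Suc e) (Suc j)) * \<phi> (Suc j)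
        + of_bool (rfree (Suc e) b) * \<phi> b \<le> len_cost (Suc e) (Suc j) b"
      by (rule Node.IH(2)[OF sub(2)]) (use split e j Node.prems in \<open>auto intro!: exI[of _ a]\<close>)
    have nn: "0 \<le> \<phi> a" "0 \<le> \<phi> b" "0 \<le> \<phi> j" "0 \<le> \<phi> (Suc j)"
      using nonneg Node.prems j by auto
    have gap: "min (\<phi> j) (\<phi> (Suc j))
        \<le> of_bool (rfree (Suc e) j) * \<phi> j + of_bool (lfree (Suc e) (Suc j)) * \<phi> (Suc j)"
      using gap_free[of j e] split nn j Node.prems by auto
    have "len_cost (Suc e) a b = len_cost e a b - mass a b"
      using len_cost_shift[of e 1] by simp
    then have at_e: "path_cost (Node l j r) a b + min_sum a b
        + of_bool (lfree (Suc e) a) * \<phi> a + of_bool (rfree (Suc e) b) * \<phi> b \<le> len_cost e a b"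
      using l r gap path_cost_Node[OF j, of l r] min_sum_split[OF j]
        len_cost_split[OF j, of "Suc e"] by linarith
    show ?thesis
    \<comment> \<open>If no level is skipped, the ends are charged as in the two halves. Otherwise
      contraction saves at least \<open>mass a b\<close>, which covers both end charges.\<close>
    proof (cases "e = d")
      case True
      then show ?thesis
        using at_e lfree_Suc[OF split(3)] rfree_Suc[OF split(4)] by simp
    next
      case False
      have ends: "of_bool (lfree d a) * \<phi> a + of_bool (rfree d b) * \<phi> b \<le> mass a b"
        using mass_ge_ends[of a b] nn j Node.prems by auto
      have "1 * mass a b \<le> real (e - d) * mass a b"
        using False e nn mass_ge_ends[of a b] j Node.prems by (intro mult_right_mono) auto
      moreover have "len_cost e a b = len_cost d a b - real (e - d) * mass a b"
        using len_cost_shift[of d "e - d"] e by simp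
      moreover have "0 \<le> of_bool (lfree (Suc e) a) * \<phi> a" "0 \<le> of_bool (rfree (Suc e) b) * \<phi> b"
        using nn by auto
      ultimately show ?thesis using at_e ends by linarith
    qed
  qed
qed

lemma avg_length_le:
  assumes "cartesian key 1 m t"
  shows "avg_length m \<phi> (path t) \<le>
    entropy m \<phi> + 2
    - \<phi> 1 * (2 - log 2 (\<phi> 1) - \<lceil>- log 2 (\<phi> 1)\<rceil>)
    - \<phi> m * (2 - log 2 (\<phi> m) - \<lceil>- log 2 (\<phi> m)\<rceil>)
    - (\<Sum>i=1..m-1. min (\<phi> i) (\<phi> (i + 1)))
    - \<phi> 1 * max 0 (\<lceil>- log 2 (\<phi> 1)\<rceil> - \<lceil>- log 2 (\<phi> 2)\<rceil> - 2)
    - \<phi> m * max 0 (\<lceil>- log 2 (\<phi> m)\<rceil> - \<lceil>- log 2 (\<phi> (m - 1))\<rceil> - 2)"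
proof -
  let ?g = "\<lambda>i. \<phi> i * (2 - log 2 (\<phi> i))"
  let ?e1 = "\<phi> 1 * (2 - log 2 (\<phi> 1) - \<lceil>- log 2 (\<phi> 1)\<rceil>)
    + \<phi> 1 * max 0 (\<lceil>- log 2 (\<phi> 1)\<rceil> - \<lceil>- log 2 (\<phi> 2)\<rceil> - 2)"
  let ?em = "\<phi> m * (2 - log 2 (\<phi> m) - \<lceil>- log 2 (\<phi> m)\<rceil>)
    + \<phi> m * max 0 (\<lceil>- log 2 (\<phi> m)\<rceil> - \<lceil>- log 2 (\<phi> (m - 1))\<rceil> - 2)"
  have "prefix_of 0 k = 0" if "k \<in> {1..m}" for k
    using mid_bounds[of k] that by (simp add: prefix_of_def floor_eq_iff)
  then have "path_cost t 1 m + min_sum 1 m + of_bool (lfree 0 1) * \<phi> 1 + of_bool (rfree 0 m) * \<phi> m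
      \<le> len_cost 0 1 m"
    by (intro path_cost_le[OF assms]) (use m_ge in auto)
  \<comment> \<open>No gap lies outside the outer symbols, so the end charges are void.\<close>
  then have "path_cost t 1 m + min_sum 1 m \<le> len_cost 0 1 m"
    by (simp add: lfree_def rfree_def)
  also have "len_cost 0 1 m = (\<Sum>i=1..m. \<phi> i * of_int (len i))"
    by (simp add: len_cost_def)
  also have "\<dots> \<le> (\<Sum>i=1..m. ?g i - (if i = 1 then ?e1 else 0) - (if i = m then ?em else 0))"
  proof (rule sum_mono)
    \<comment> \<open>Turns the caps in \<open>len\<close> into the \<open>max\<close>
      terms.\<close>
    have *: "min x (y + 2) = x - max 0 (x - y - 2)" for x y :: int by auto
    fix i assume i: "i \<in> {1..m}"
    consider "i = 1" "i \<noteq> m" | "i = m" "i \<noteq> 1" | "i \<noteq> 1" "i \<noteq> m" using m_ge by fastforce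
    then show "\<phi> i * of_int (len i)
        \<le> ?g i - (if i = 1 then ?e1 else 0) - (if i = m then ?em else 0)"
    proof cases
      case 1
      then show ?thesis by (simp add: len_def * right_diff_distrib)
    next
      case 2
      then show ?thesis by (simp add: len_def * right_diff_distrib)
    next
      case 3
      then have "of_int (len i) \<le> 2 - log 2 (\<phi> i)" unfolding len_def by simp
      then show ?thesis
        using 3 nonneg[OF i] by (simp add: mult_left_mono)
    qed
  qed
  also have "\<dots> = (\<Sum>i=1..m. ?g i) - ?e1 - ?em"
    using m_ge by (simp add: sum_subtractf)
  also have "(\<Sum>i=1..m. ?g i) = entropy m \<phi> + 2"
    using sum_one by (simp add: entropy_def right_diff_distrib sum_subtractf flip: sum_distrib_right)
  finally have "path_cost t 1 m + min_sum 1 m \<le> entropy m \<phi> + 2 - ?e1 - ?em" .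
  moreover have "min_sum 1 m = (\<Sum>i=1..m-1. min (\<phi> i) (\<phi> (i + 1)))"
    unfolding min_sum_def using m_ge by (intro sum.cong) auto
  ultimately show ?thesis
    unfolding avg_length_def path_cost_def by linarith
qed

end

section \<open>Linear-time construction\<close>

fun root :: "nat \<Rightarrow> gap_tree \<Rightarrow> nat" where
  "root m (Leaf i) = i"
| "root m (Node _ j _) = m + j"

fun stores_tree :: "nat \<Rightarrow> (nat \<Rightarrow> real) \<Rightarrow> (nat \<Rightarrow> real) \<Rightarrow> gap_tree \<Rightarrow> bool" where
  "stores_tree m L R (Leaf _) \<longleftrightarrow> True"
| "stores_tree m L R (Node l j r) \<longleftrightarrow> L (m + j) = real (root m l) \<and> R (m + j) = real (root m r) \<and>
     stores_tree m L R l \<and> stores_tree m L R r"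

lemma tree_path_leaf: "v \<le> m \<Longrightarrow> tree_path m s v bs u \<longleftrightarrow> bs = [] \<and> u = v"
  by (auto elim: tree_path.cases intro: tree_path.Nil)

lemma tree_path_inner:
  assumes "m < v" "arr s 1 v = real x" "arr s 2 v = real y" "u \<le> m"
  shows "tree_path m s v bs u \<longleftrightarrow>
    (\<exists>b bs'. bs = b # bs' \<and> tree_path m s (if b then y else x) bs' u)"
proof
  assume "tree_path m s v bs u"
  then show "\<exists>b bs'. bs = b # bs' \<and> tree_path m s (if b then y else x) bs' u"
    using assms by (cases rule: tree_path.cases) (auto split: if_splits)
next
  assume "\<exists>b bs'. bs = b # bs' \<and> tree_path m s (if b then y else x) bs' u"
  then show "tree_path m s v bs u"
    using assms by (auto intro!: tree_path.Cons)
qed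

text \<open>The subtrees have disjoint ranges of leaves, so the leaf forces every letter;
  \<open>1 \<le> a\<close> makes \<open>m + j\<close> an inner node.\<close>

lemma tree_path_root:
  assumes "cartesian Y a b t" "stores_tree m (arr s 1) (arr s 2) t" "1 \<le> a" "b \<le> m" "u \<le> m"
  shows "tree_path m s (root m t) bs u \<longleftrightarrow> u \<in> {a..b} \<and> bs = path t u"
  using assms
proof (induction t arbitrary: a b bs)
  case (Leaf i)
  then show ?case by (auto simp: tree_path_leaf)
next
  case (Node l j r)
  have l: "tree_path m s (root m l) bs' u \<longleftrightarrow> u \<in> {a..j} \<and> bs' = path l u" for bs'
    using Node.IH(1)[of a j] Node.prems by auto
  have r: "tree_path m s (root m r) bs' u \<longleftrightarrow> u \<in> {Suc j..b} \<and> bs' = path r u" for bs'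
    using Node.IH(2)[of "Suc j" b] Node.prems by auto
  have "tree_path m s (m + j) bs u \<longleftrightarrow>
    (\<exists>b bs'. bs = b # bs' \<and> tree_path m s (if b then root m r else root m l) bs' u)"
    by (rule tree_path_inner) (use Node.prems in auto)
  also have "\<dots> \<longleftrightarrow> (\<exists>bs'. bs = True # bs' \<and> tree_path m s (root m r) bs' u)
      \<or> (\<exists>bs'. bs = False # bs' \<and> tree_path m s (root m l) bs' u)"
    by (metis (full_types))
  also have "\<dots> \<longleftrightarrow> u \<in> {a..b} \<and> bs = path (Node l j r) u"
    using Node.prems by (auto simp: l r)
  finally show ?case by simp
qed

lemma outputs_code_path:
  assumes "cartesian Y 1 m t" "stores_tree m (arr s 1) (arr s 2) t" "var s 1 = real (root m t)"
  shows "outputs_code m s (path t)"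
  unfolding outputs_code_def using assms tree_path_root[OF assms(1,2)] by auto

lemma stores_tree_cong:
  "cartesian Y a b t \<Longrightarrow> (\<And>k. a \<le> k \<Longrightarrow> k < b \<Longrightarrow> L' (m + k) = L (m + k) \<and> R' (m + k) = R (m + k)) \<Longrightarrow>
    stores_tree m L' R' t \<longleftrightarrow> stores_tree m L R t"
proof (induction t arbitrary: a b)
  case (Node l j r)
  then show ?case using Node.IH(1)[of a j] Node.IH(2)[of "Suc j" b] by auto
qed simp

text \<open>An entry \<open>(a, j, t)\<close> of the stack is a gap \<open>j\<close> whose left subtree \<open>t\<close> has the leaves \<open>a, \<dots>, j\<close>
  and whose right subtree is not yet complete; \<open>e\<close> is the last leaf covered by the stack.\<close>

fun stack_ok :: "(nat \<Rightarrow> real) \<Rightarrow> nat \<Rightarrow> (nat \<times> nat \<times> gap_tree) list \<Rightarrow> bool" where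
  "stack_ok Y e [] \<longleftrightarrow> e = 0"
| "stack_ok Y e ((a, j, t) # st) \<longleftrightarrow> j = e \<and> 1 \<le> a \<and> cartesian Y a j t \<and>
     (\<forall>k\<in>{a..<j}. Y k \<le> Y j) \<and> (1 < a \<longrightarrow> Y j \<le> Y (a - 1)) \<and> stack_ok Y (a - 1) st"

fun top :: "nat \<Rightarrow> (nat \<times> nat \<times> gap_tree) list \<Rightarrow> nat" where
  "top m [] = 0"
| "top m ((_, j, _) # _) = m + j"

fun stores_stack :: "nat \<Rightarrow> (nat \<Rightarrow> real) \<Rightarrow> (nat \<Rightarrow> nat \<Rightarrow> real) \<Rightarrow> (nat \<times> nat \<times> gap_tree) list \<Rightarrow> bool" where
  "stores_stack m Y A [] \<longleftrightarrow> True"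
| "stores_stack m Y A ((a, j, t) # st) \<longleftrightarrow> A 1 (m + j) = real (root m t) \<and>
     A 3 (m + j) = real (top m st) \<and> A 4 (m + j) = Y j \<and>
     stores_tree m (A 1) (A 2) t \<and> stores_stack m Y A st"

text \<open>The stack occupies only nodes up to \<open>m + e\<close>, so writing to later nodes
  leaves it intact.\<close>

lemma stores_stack_cong:
  "stack_ok Y e st \<Longrightarrow> (\<And>n k. k \<le> e \<Longrightarrow> A' n (m + k) = A n (m + k)) \<Longrightarrow>
    stores_stack m Y A' st \<longleftrightarrow> stores_stack m Y A st"
proof (induction st arbitrary: e)
  case (Cons x st)
  obtain a j t where x: "x = (a, j, t)" by (cases x)
  have "stores_tree m (A' 1) (A' 2) t \<longleftrightarrow> stores_tree m (A 1) (A 2) t"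
    using Cons.prems x by (intro stores_tree_cong[of Y a j]) auto
  moreover have "stores_stack m Y A' st \<longleftrightarrow> stores_stack m Y A st"
  proof (rule Cons.IH[of "a - 1"])
    show "stack_ok Y (a - 1) st" using Cons.prems x by simp
    have "a - 1 \<le> e" using Cons.prems(1) x cartesian_le[of Y a j t] by auto
    then show "A' n (m + k) = A n (m + k)" if "k \<le> a - 1" for n k
      using Cons.prems(2) that by (meson le_trans)
  qed
  ultimately show ?case
    using Cons.prems x by auto
qed simp

section \<open>Straight-line code\<close>

fun straight :: "com \<Rightarrow> bool" where
  "straight (Assign _ _) \<longleftrightarrow> True"
| "straight (Store _ _ _) \<longleftrightarrow> True"
| "straight (Seq c d) \<longleftrightarrow> straight c \<and> straight d"
| "straight _ \<longleftrightarrow> False"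

fun run :: "com \<Rightarrow> state \<Rightarrow> state" where
  "run (Assign x e) s = s\<lparr>var := (var s)(x := aval e s)\<rparr>"
| "run (Store a e1 e2) s =
    s\<lparr>arr := (arr s)(a := (arr s a)(nat \<lfloor>aval e1 s\<rfloor> := aval e2 s))\<rparr>"
| "run (Seq c d) s = run d (run c s)"
| "run _ s = s"

fun cost :: "com \<Rightarrow> nat" where
  "cost (Assign _ e) = 1 + acost e"
| "cost (Store _ e1 e2) = 1 + acost e1 + acost e2"
| "cost (Seq c d) = cost c + cost d"
| "cost _ = 0"

lemma exec_straight: "straight c \<Longrightarrow> exec c s (cost c) (run c s)"
proof (induction c arbitrary: s)
  case (Seq c d)
  then show ?case using exec.Seq[of c s "cost c" "run c s"] by simp
qed (simp_all only: cost.simps run.simps straight.simps exec.Assign exec.Store)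

text \<open>Variables: 0 holds \<open>m\<close>, 1 the root of the current subtree, 2 the current symbol \<open>i\<close>, 3 the
  cumulative mass, 4 the top of the stack (0 if empty), 5 the key of gap \<open>i\<close>. The stack is a linked
  list of nodes \<open>m + j\<close>, with array 3 for the links and array 4 for the keys.\<close>

definition pop_guard :: bexp where
  "pop_guard = Conj (Less (Const 0) (Var 4)) (Less (Cell 4 (Var 4)) (Var 5))"

text \<open>The right child is written only on popping: a larger key further right shows that the
  right subtree, which is the current one, is complete.\<close>

definition pop_body :: com where
  "pop_body = Seq (Store 2 (Var 4) (Var 1)) (Seq (Assign 1 (Var 4)) (Assign 4 (Cell 3 (Var 4))))"

definition plus :: "aexp \<Rightarrow> aexp \<Rightarrow> aexp" where
  "plus = Binop Add_op"

text \<open>Variables 6 and 7 receive \<open>mid i\<close> and \<open>mid (Suc i)\<close>; for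
  \<open>i = m\<close> the cell read beyond the input is 0, which gives the sentinel.\<close>

definition load_code :: com where
  "load_code =
    Seq (Assign 1 (Var 2))
    (Seq (Assign 6 (plus (Var 3) (Binop Div_op (Cell 0 (Var 2)) (Const 2))))
    (Seq (Assign 3 (plus (Var 3) (Cell 0 (Var 2))))
    (Seq (Assign 7 (plus (Var 3) (Binop Div_op (Cell 0 (plus (Var 2) (Const 1))) (Const 2))))
    (Assign 5 (Binop Sub_op (plus (Binop Xor_op (Var 6) (Var 7)) (Var 7)) (Var 6))))))"

text \<open>Variable 1 keeps its value, so after the last symbol it still holds the root of the
  whole tree.\<close>

definition push_code :: com where
  "push_code =
    Seq (Store 1 (plus (Var 0) (Var 2)) (Var 1))
    (Seq (Store 3 (plus (Var 0) (Var 2)) (Var 4))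
    (Seq (Store 4 (plus (Var 0) (Var 2)) (Var 5))
    (Seq (Assign 4 (plus (Var 0) (Var 2)))
    (Assign 2 (plus (Var 2) (Const 1))))))"

definition build_body :: com where
  "build_body = Seq load_code (Seq (WHILE pop_guard pop_body) push_code)"

definition build_guard :: bexp where
  "build_guard = Neg (Less (Var 0) (Var 2))"

definition build :: com where
  "build = Seq (Assign 2 (Const 1)) (WHILE build_guard build_body)"

section \<open>Invariants and running time of the loops\<close>

lemma pop_guard_cost: "bcost pop_guard = 8"
  by (simp add: pop_guard_def eval_nat_numeral)

lemma pop_body_cost: "cost pop_body = 8"
  by (simp add: pop_body_def eval_nat_numeral)

lemma load_code_cost: "cost load_code = 31"
  by (simp add: load_code_def plus_def eval_nat_numeral)

lemma push_code_cost: "cost push_code = 23"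
  by (simp add: push_code_def plus_def eval_nat_numeral)

text \<open>The keys in the current subtree are at most \<open>y\<close>, so it can become the left
  subtree of the new gap, and at most the key on top of the stack, so it can become the right
  subtree there. Each stack entry carries 18 units, which pay the 17 for its removal; 9 pay for the
  last test.\<close>

lemma exec_pop_loop:
  assumes "stack_ok Y (a - 1) st" "1 \<le> a" "cartesian Y a i t"
    and "\<forall>k\<in>{a..<i}. Y k \<le> y" "\<forall>k\<in>{a..<i}. 1 < a \<longrightarrow> Y k \<le> Y (a - 1)"
    and "stores_tree m (arr s 1) (arr s 2) t" "stores_stack m Y (arr s) st"
    and "var s 1 = real (root m t)" "var s 4 = real (top m st)" "var s 5 = y"
  shows "\<exists>n s' a' t' st'. exec (WHILE pop_guard pop_body) s n s' \<and>
    n + 18 * length st' \<le> 18 * length st + 9 \<and>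
    stack_ok Y (a' - 1) st' \<and> 1 \<le> a' \<and> cartesian Y a' i t' \<and>
    (\<forall>k\<in>{a'..<i}. Y k \<le> y) \<and> (1 < a' \<longrightarrow> y \<le> Y (a' - 1)) \<and>
    stores_tree m (arr s' 1) (arr s' 2) t' \<and> stores_stack m Y (arr s') st' \<and>
    var s' 1 = real (root m t') \<and> var s' 4 = real (top m st') \<and>
    (\<forall>x\<in>{0, 2, 3, 5}. var s' x = var s x) \<and> arr s' 0 = arr s 0"
  using assms
proof (induction st arbitrary: a t s)
  case Nil
  \<comment> \<open>The guard also reads cell 0 of array 4 here; its first conjunct fails whatever
    that cell holds.\<close>
  have "\<not> bval pop_guard s" using Nil.prems by (simp add: pop_guard_def)
  then have "exec (WHILE pop_guard pop_body) s 9 s"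
    using exec.WhileFalse[of pop_guard s pop_body] by (simp add: pop_guard_cost)
  then show ?case
    using Nil.prems by (intro exI[of _ 9] exI[of _ s] exI[of _ a] exI[of _ t] exI[of _ "[]"]) auto
next
  case (Cons x st)
  obtain b j l where x: "x = (b, j, l)" by (cases x)
  have j: "j = a - 1" "1 \<le> b" "cartesian Y b j l" "1 < a" "Suc j = a" "b \<le> j"
    and below: "\<forall>k\<in>{b..<j}. Y k \<le> Y j" "1 < b \<longrightarrow> Y j \<le> Y (b - 1)" "stack_ok Y (b - 1) st"
    using Cons.prems(1) x cartesian_le[of Y b j l] by auto
  have top: "nat \<lfloor>var s 4\<rfloor> = m + j" "var s 4 = real (m + j)"
    using Cons.prems x by auto
  have cells: "arr s 4 (m + j) = Y j" "arr s 3 (m + j) = real (top m st)"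
    "arr s 1 (m + j) = real (root m l)"
    using Cons.prems x by auto
  have guard: "bval pop_guard s \<longleftrightarrow> Y j < y"
  proof -
    have "0 < var s 4" using top(2) j(2,6) by simp
    then show ?thesis
      using Cons.prems(10) top(1) cells(1) by (simp add: pop_guard_def)
  qed
  show ?case
  proof (cases "Y j < y")
    case False
    then have "exec (WHILE pop_guard pop_body) s 9 s"
      using exec.WhileFalse[of pop_guard s pop_body] guard by (simp add: pop_guard_cost)
    then show ?thesis
      using Cons.prems False j
      by (intro exI[of _ 9] exI[of _ s] exI[of _ a] exI[of _ t] exI[of _ "x # st"]) auto
  next
    case True
    define s1 where "s1 = run pop_body s"
    have body: "exec pop_body s 8 s1"
      using exec_straight[of pop_body s] unfolding pop_body_cost s1_def by (simp add: pop_body_def)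
    have arr: "arr s1 = (arr s)(2 := (arr s 2)(m + j := real (root m t)))"
      using Cons.prems(8) top by (simp add: s1_def pop_body_def)
    have var: "var s1 = (var s)(1 := real (m + j), 4 := real (top m st))"
      using cells top by (simp add: s1_def pop_body_def)
    have "stores_tree m (arr s1 1) (arr s1 2) l \<longleftrightarrow> stores_tree m (arr s 1) (arr s 2) l"
      by (rule stores_tree_cong[OF j(3)]) (auto simp: arr)
    moreover have "stores_tree m (arr s1 1) (arr s1 2) t \<longleftrightarrow> stores_tree m (arr s 1) (arr s 2) t"
      by (rule stores_tree_cong[OF Cons.prems(3)]) (use j in \<open>auto simp: arr\<close>)
    ultimately have tree: "stores_tree m (arr s1 1) (arr s1 2) (Node l j t)"
      using Cons.prems(6,7) x cells by (simp add: arr)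
    have "stores_stack m Y (arr s1) st \<longleftrightarrow> stores_stack m Y (arr s) st"
      by (rule stores_stack_cong[OF below(3)]) (use j in \<open>auto simp: arr\<close>)
    then have stack: "stores_stack m Y (arr s1) st"
      using Cons.prems(7) x by simp
    \<comment> \<open>The popped key dominates its left subtree by \<open>stack_ok\<close> and the
      current subtree by the premise about \<open>Y (a - 1)\<close>.\<close>
    have le: "Y k \<le> Y j" if "k \<in> {b..<i}" for k
    proof -
      consider "k \<in> {b..<j}" | "k = j" | "k \<in> {a..<i}" using \<open>k \<in> {b..<i}\<close> j by fastforce
      then show ?thesis
        using below(1) Cons.prems(5) j by cases auto
    qed
    have node: "cartesian Y b i (Node l j t)"
      using le j Cons.prems(3) cartesian_le[OF Cons.prems(3)] by auto
    have le_y: "\<forall>k\<in>{b..<i}. Y k \<le> y"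
      and le_below: "\<forall>k\<in>{b..<i}. 1 < b \<longrightarrow> Y k \<le> Y (b - 1)"
      using le True below(2) by force+
    have vars: "var s1 1 = real (root m (Node l j t))" "var s1 4 = real (top m st)" "var s1 5 = y"
      using Cons.prems(10) by (simp_all add: var)
    obtain n s' a' t' st' where IH: "exec (WHILE pop_guard pop_body) s1 n s'"
      "n + 18 * length st' \<le> 18 * length st + 9"
      "stack_ok Y (a' - 1) st'" "1 \<le> a'" "cartesian Y a' i t'"
      "\<forall>k\<in>{a'..<i}. Y k \<le> y" "1 < a' \<longrightarrow> y \<le> Y (a' - 1)"
      "stores_tree m (arr s' 1) (arr s' 2) t'" "stores_stack m Y (arr s') st'"
      "var s' 1 = real (root m t')" "var s' 4 = real (top m st')"
      "\<forall>x\<in>{0, 2, 3, 5}. var s' x = var s1 x" "arr s' 0 = arr s1 0"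
      using Cons.IH[OF below(3) j(2) node le_y le_below tree stack vars] by blast
    have "exec (WHILE pop_guard pop_body) s (1 + bcost pop_guard + 8 + n) s'"
      using guard True body IH(1) by (intro exec.WhileTrue) auto
    then have "exec (WHILE pop_guard pop_body) s (17 + n) s'"
      by (simp add: pop_guard_cost)
    then show ?thesis
      using IH(2-) by (intro exI[of _ "17 + n"] exI[of _ s'] exI[of _ a'] exI[of _ t'] exI[of _ st'])
        (auto simp: var arr)
  qed
qed

section \<open>The outer loop\<close>

context distribution
begin

definition build_inv :: "nat \<Rightarrow> state \<Rightarrow> (nat \<times> nat \<times> gap_tree) list \<Rightarrow> bool" where
  "build_inv i s st \<longleftrightarrow> var s 0 = real m \<and> var s 2 = real i \<and> var s 3 = cum (i - 1) \<and>
     var s 4 = real (top m st) \<and> (\<forall>k. arr s 0 k = (if k \<in> {1..m} then \<phi> k else 0)) \<and>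
     stack_ok key (i - 1) st \<and> stores_stack m key (arr s) st"

text \<open>Straight-line code takes 54 units, the last pop test 9, and 18 are deposited for the
  pushed entry: less than 100.\<close>

lemma exec_build_body:
  assumes inv: "build_inv i s st" and i: "1 \<le> i" "i \<le> m"
  shows "\<exists>n s' st'. exec build_body s n s' \<and> n + 18 * length st' \<le> 18 * length st + 100 \<and>
    build_inv (Suc i) s' st' \<and>
    (i = m \<longrightarrow> (\<exists>t. cartesian key 1 m t \<and> stores_tree m (arr s' 1) (arr s' 2) t \<and>
      var s' 1 = real (root m t)))"
proof -
  have v: "var s 0 = real m" "var s 2 = real i" "var s 3 = cum (i - 1)" "var s 4 = real (top m st)"
    and a0: "\<And>k. arr s 0 k = (if k \<in> {1..m} then \<phi> k else 0)"
    and st: "stack_ok key (i - 1) st" "stores_stack m key (arr s) st"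
    using inv by (auto simp: build_inv_def)
  have nat_add: "nat (int x + int y) = x + y" "nat (int x + 1) = Suc x" for x y by linarith+
    define s1 where "s1 = run load_code s"
  have e1: "exec load_code s 31 s1"
    using exec_straight[of load_code s] unfolding load_code_cost s1_def
    by (simp add: load_code_def)
  have arr1: "arr s1 = arr s" by (simp add: s1_def load_code_def)
  have mids: "mid i = cum (i - 1) + \<phi> i / 2" "cum i = cum (i - 1) + \<phi> i"
    "mid (Suc i) = cum i + (if Suc i \<le> m then \<phi> (Suc i) / 2 else 0)"
    using i cum_diff[of i] by (auto simp: mid_def)
  have "var s1 5 = split_key (mid i) (mid (Suc i))"
    using i mids by (simp add: s1_def load_code_def plus_def v a0 nat_add split_key_def)
  then have var1: "var s1 0 = real m" "var s1 1 = real i" "var s1 2 = real i" "var s1 3 = cum i"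
    "var s1 4 = real (top m st)" "var s1 5 = key i"
    using i mids by (simp_all add: s1_def load_code_def plus_def v a0 key_def)
  have leaf: "cartesian key i i (Leaf i)"
    and none: "\<forall>k\<in>{i..<i}. key k \<le> key i" "\<forall>k\<in>{i..<i}. 1 < i \<longrightarrow> key k \<le> key (i - 1)"
    and stores_leaf: "stores_tree m (arr s1 1) (arr s1 2) (Leaf i)"
    by simp_all
  have st1: "stores_stack m key (arr s1) st" using st(2) arr1 by simp
  have vars1: "var s1 1 = real (root m (Leaf i))" "var s1 4 = real (top m st)" "var s1 5 = key i"
    using var1 by simp_all
  obtain n s2 a t st' where loop: "exec (WHILE pop_guard pop_body) s1 n s2"
    "n + 18 * length st' \<le> 18 * length st + 9"
    "stack_ok key (a - 1) st'" "1 \<le> a" "cartesian key a i t"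
    "\<forall>k\<in>{a..<i}. key k \<le> key i" "1 < a \<longrightarrow> key i \<le> key (a - 1)"
    "stores_tree m (arr s2 1) (arr s2 2) t" "stores_stack m key (arr s2) st'"
    "var s2 1 = real (root m t)" "var s2 4 = real (top m st')"
    "\<forall>x\<in>{0, 2, 3, 5}. var s2 x = var s1 x" "arr s2 0 = arr s1 0"
    using exec_pop_loop[OF st(1) i(1) leaf none stores_leaf st1 vars1] by blast
  have ai: "a \<le> i" using cartesian_le[OF loop(5)] .
  define s3 where "s3 = run push_code s2"
  have e3: "exec push_code s2 23 s3"
    using exec_straight[of push_code s2] unfolding push_code_cost s3_def
    by (simp add: push_code_def)
  have v2: "var s2 0 = real m" "var s2 2 = real i" "var s2 3 = cum i" "var s2 5 = key i"
    using loop(12) var1 by (simp_all)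
  have arr3: "arr s3 = (arr s2)(1 := (arr s2 1)(m + i := real (root m t)),
      3 := (arr s2 3)(m + i := real (top m st')), 4 := (arr s2 4)(m + i := key i))"
    using v2 loop(10,11) by (simp add: s3_def push_code_def plus_def nat_add)
  have var3: "var s3 = (var s2)(4 := real (m + i), 2 := real (Suc i))"
    using v2 by (simp add: s3_def push_code_def plus_def add.commute)
  have tree3: "stores_tree m (arr s3 1) (arr s3 2) t"
    using loop(8) stores_tree_cong[OF loop(5), of "arr s3 1" m "arr s2 1" "arr s3 2" "arr s2 2"]
    by (auto simp: arr3)
  have "stores_stack m key (arr s3) st' \<longleftrightarrow> stores_stack m key (arr s2) st'"
    by (rule stores_stack_cong[OF loop(3)]) (use ai loop(4) in \<open>auto simp: arr3\<close>)
  then have "stores_stack m key (arr s3) ((a, i, t) # st')"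
    using loop(9) tree3 by (simp add: arr3)
  moreover have "stack_ok key i ((a, i, t) # st')"
    using loop by simp
  ultimately have inv': "build_inv (Suc i) s3 ((a, i, t) # st')"
    using v2 loop(13) a0 by (simp add: build_inv_def var3 arr3 arr1 stack_ok.simps)
  \<comment> \<open>The sentinel key exceeds all earlier keys, so the last round empties the stack
    and the current subtree covers all leaves.\<close>
  have "a = 1" if "i = m"
  proof (rule ccontr)
    assume "a \<noteq> 1"
    then have "2 \<le> key (a - 1)" "1 \<le> a - 1" "a - 1 < m"
      using loop(4,7) ai that key_last by auto
    then show False using key_less_two[of "a - 1"] by simp
  qed
  then have final: "i = m \<longrightarrow> (\<exists>t. cartesian key 1 m t \<and> stores_tree m (arr s3 1) (arr s3 2) t \<and>
      var s3 1 = real (root m t))"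
    using loop(5,10) tree3 by (auto simp: var3)
  have "exec build_body s (31 + (n + 23)) s3"
    unfolding build_body_def by (intro exec.Seq[OF e1] exec.Seq[OF loop(1)] e3)
  then show ?thesis
    using inv' final loop(2)
    by (intro exI[of _ "31 + (n + 23)"] exI[of _ s3] exI[of _ "(a, i, t) # st'"])
      (simp)
qed

lemma build_guard_cost: "bcost build_guard = 4"
  by (simp add: build_guard_def)

text \<open>Each round adds 5 units for the outer guard to the amortized 100; the final test takes 5
  more.\<close>

lemma exec_build_loop:
  assumes "build_inv i s st" "1 \<le> i" "i \<le> m"
  shows "\<exists>n s' t. exec (WHILE build_guard build_body) s n s' \<and>
    n \<le> 105 * (Suc m - i) + 18 * length st + 5 \<and> cartesian key 1 m t \<and>
    stores_tree m (arr s' 1) (arr s' 2) t \<and> var s' 1 = real (root m t)"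
  using assms
proof (induction "Suc m - i" arbitrary: i s st)
  case (Suc d)
  obtain n s' st' where body: "exec build_body s n s'"
    "n + 18 * length st' \<le> 18 * length st + 100" "build_inv (Suc i) s' st'"
    "i = m \<longrightarrow> (\<exists>t. cartesian key 1 m t \<and> stores_tree m (arr s' 1) (arr s' 2) t \<and>
      var s' 1 = real (root m t))"
    using exec_build_body[OF Suc.prems] by blast
  have guard: "bval build_guard s"
    using Suc.prems by (simp add: build_guard_def build_inv_def)
  show ?case
  proof (cases "i = m")
    case True
    have "\<not> bval build_guard s'"
      using body(3) True by (simp add: build_guard_def build_inv_def)
    then have "exec (WHILE build_guard build_body) s' 5 s'"
      using exec.WhileFalse[of build_guard s'] by (simp add: build_guard_cost)
    from exec.WhileTrue[OF guard body(1) this]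
    have "exec (WHILE build_guard build_body) s (10 + n) s'"
      by (simp add: build_guard_cost)
    then show ?thesis
      using body(2,4) True by (intro exI[of _ "10 + n"] exI[of _ s']) auto
  next
    case False
    have next_i: "d = Suc m - Suc i" "1 \<le> Suc i" "Suc i \<le> m"
      using False Suc.hyps(2) Suc.prems by auto
    obtain n' s'' t where rest: "exec (WHILE build_guard build_body) s' n' s''"
      "n' \<le> 105 * (Suc m - Suc i) + 18 * length st' + 5" "cartesian key 1 m t"
      "stores_tree m (arr s'' 1) (arr s'' 2) t" "var s'' 1 = real (root m t)"
      using Suc.hyps(1)[OF next_i(1) body(3) next_i(2,3)] by blast
    from exec.WhileTrue[OF guard body(1) rest(1)]
    have "exec (WHILE build_guard build_body) s (5 + n + n') s''"
      by (simp add: build_guard_cost add.commute add.left_commute)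
    moreover have "Suc m - i = Suc (Suc m - Suc i)" using Suc.prems by simp
    ultimately show ?thesis
      using body(2) rest(2-) by (intro exI[of _ "5 + n + n'"] exI[of _ s''] exI[of _ t]) auto
  qed
qed auto

text \<open>The initial assignment takes 2 units, and \<open>105 * m + 7 \<le> 110 * m\<close>
  because \<open>m \<ge> 2\<close>.\<close>

lemma exec_build:
  "\<exists>n s t. exec build (input_state m \<phi>) n s \<and> n \<le> 110 * m \<and>
    outputs_code m s (path t) \<and> cartesian key 1 m t"
proof -
  let ?s = "run (Assign 2 (Const 1)) (input_state m \<phi>)"
  have "build_inv 1 ?s []"
    by (simp add: build_inv_def input_state_def cum_simps)
  then have "\<exists>n s t. exec (WHILE build_guard build_body) ?s n s \<and> n \<le> 105 * m + 5 \<and>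
      cartesian key 1 m t \<and> stores_tree m (arr s 1) (arr s 2) t \<and> var s 1 = real (root m t)"
    using exec_build_loop[of 1 ?s "[]"] m_ge by (simp del: run.simps)
  then obtain n s t where loop: "exec (WHILE build_guard build_body) ?s n s"
    "n \<le> 105 * m + 5" "cartesian key 1 m t"
    "stores_tree m (arr s 1) (arr s 2) t" "var s 1 = real (root m t)"
    by blast
  have "exec build (input_state m \<phi>) (2 + n) s"
    unfolding build_def
    using exec.Seq[OF exec_straight[of "Assign 2 (Const 1)"] loop(1)] by simp
  then show ?thesis
    using loop(2,3) outputs_code_path[OF loop(3-5)] m_ge
    by (intro exI[of _ "2 + n"] exI[of _ s] exI[of _ t]) auto
qed

end

text \<open>For two symbols of probability 1/2 the right-hand side is 1/2, whereas nonempty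
  codewords have average length at least 1; hence the exclusion.\<close>

theorem corollary4p2:
  shows "\<exists>(P :: com) (K :: nat). \<forall>(m :: nat) (\<phi> :: nat \<Rightarrow> real).
    m \<ge> 2 \<and> prob_distribution m \<phi> \<and>
    \<phi> 1 > 0 \<and> \<phi> 2 > 0 \<and> \<phi> (m - 1) > 0 \<and> \<phi> m > 0 \<and>
    \<not> (m = 2 \<and> \<phi> 1 = 1 / 2 \<and> \<phi> 2 = 1 / 2) \<longrightarrow>
    (\<exists>n t w.
       exec P (input_state m \<phi>) n t \<and> n \<le> K * m \<and>
       outputs_code m t w \<and> alphabetic_code m w \<and>
       avg_length m \<phi> w \<le>
         entropy m \<phi> + 2
         - \<phi> 1 * (2 - log 2 (\<phi> 1) - \<lceil>- log 2 (\<phi> 1)\<rceil>)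
         - \<phi> m * (2 - log 2 (\<phi> m) - \<lceil>- log 2 (\<phi> m)\<rceil>)
         - (\<Sum>i=1..m-1. min (\<phi> i) (\<phi> (i + 1)))
         - \<phi> 1 * max 0 (\<lceil>- log 2 (\<phi> 1)\<rceil> - \<lceil>- log 2 (\<phi> 2)\<rceil> - 2)
         - \<phi> m * max 0 (\<lceil>- log 2 (\<phi> m)\<rceil> - \<lceil>- log 2 (\<phi> (m - 1))\<rceil> - 2))"
proof (rule exI[of _ build], rule exI[of _ 110], intro allI impI)
  fix m :: nat and \<phi> :: "nat \<Rightarrow> real"
  assume A: "m \<ge> 2 \<and> prob_distribution m \<phi> \<and>
    \<phi> 1 > 0 \<and> \<phi> 2 > 0 \<and> \<phi> (m - 1) > 0 \<and> \<phi> m > 0 \<and>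
    \<not> (m = 2 \<and> \<phi> 1 = 1 / 2 \<and> \<phi> 2 = 1 / 2)"
  \<comment> \<open>For \<open>m = 2\<close>, \<open>\<phi> 1 = 1 / 2\<close> forces
    \<open>\<phi> 2 = 1 / 2\<close>, which turns the exclusion into \<open>not_half\<close>.\<close>
  have "(\<Sum>i=1..2. \<phi> i) = \<phi> 1 + \<phi> 2" by (simp add: numeral_2_eq_2)
  with A interpret distribution m \<phi>
    by unfold_locales (auto simp: prob_distribution_def)
  obtain n s t where "exec build (input_state m \<phi>) n s" "n \<le> 110 * m"
    "outputs_code m s (path t)" and t: "cartesian key 1 m t"
    using exec_build by blast
  then show "\<exists>n t w. exec build (input_state m \<phi>) n t \<and> n \<le> 110 * m \<and>
      outputs_code m t w \<and> alphabetic_code m w \<and>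
      avg_length m \<phi> w \<le>
        entropy m \<phi> + 2
        - \<phi> 1 * (2 - log 2 (\<phi> 1) - \<lceil>- log 2 (\<phi> 1)\<rceil>)
        - \<phi> m * (2 - log 2 (\<phi> m) - \<lceil>- log 2 (\<phi> m)\<rceil>)
        - (\<Sum>i=1..m-1. min (\<phi> i) (\<phi> (i + 1)))
        - \<phi> 1 * max 0 (\<lceil>- log 2 (\<phi> 1)\<rceil> - \<lceil>- log 2 (\<phi> 2)\<rceil> - 2)
        - \<phi> m * max 0 (\<lceil>- log 2 (\<phi> m)\<rceil> - \<lceil>- log 2 (\<phi> (m - 1))\<rceil> - 2)"
    using alphabetic_code_path[OF t m_ge] avg_length_le[OF t] by blast
qed

end
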